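(* Let $\mathbf{G}$ be a spray on a smooth two-dimensional manifold $M$ and let $dV$ be a volume form on $M$. Then the Berwald-Weyl curvature $\mathbf{W}^{o}=W^o_k\,dx^k$ of $(\mathbf{G},dV)$ is independent of $dV$ and is given by $$W^{o}_{k}=R_{|k}-\frac{1}{2}R_{\cdot k|m}y^{m}-\frac{1}{3}\chi_{k|m}y^{m},$$ where $R$ and $\chi_k$ are the Ricci scalar and the $\chi$-curvature of $\mathbf{G}$ and $|$ is the horizontal covariant derivative with respect to $\mathbf{G}$. Hence $\mathbf{W}^o$ is a projective invariant of $\mathbf{G}$, i.e. projectively equivalent sprays on $M$ have the same $\mathbf{W}^o$.
   Context: Here $n=\dim M=2$. Let $(x^i,y^i)$ be standard local coordinates on $TM$, $TM_0=TM\setminus\{0\}$; the summation convention is used and $f_{\cdot k}=\partial f/\partial y^k$. Spray: a smooth vector field on $TM_0$ of the local form $\mathbf{G}=y^{i}\frac{\partial}{\partial x^{i}}-2G^{i}\frac{\partial}{\partial y^{i}}$ with $G^i(x,\lambda y)=\lambda^2G^i(x,y)$ for all $\lambda>0$. Two sprays with coefficients $G^i$, $\bar G^i$ are projectively equivalent if $\bar G^i=G^i+Py^i$ for some function $P$ on $TM_0$ with $P(x,\lambda y)=\lambda P(x,y)$, $\lambda>0$. Put $N^i_j=\partial G^i/\partial y^j$, $\Gamma^i_{jk}=\partial^2G^i/\partial y^j\partial y^k$ (Berwald connection), $\frac{\delta}{\delta x^k}=\frac{\partial}{\partial x^k}-N^l_k\frac{\partial}{\partial y^l}$. The horizontal covariant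 derivative $|$ with respect to $\mathbf{G}$ is that of the Berwald connection: $f_{|k}=\frac{\delta f}{\delta x^k}$, $A_{k|m}=\frac{\delta A_k}{\delta x^m}-\Gamma^l_{km}A_l$; $R_{\cdot k|m}$ means $(R_{\cdot k})_{|m}$. Curvatures of $\mathbf{G}$: Riemann curvature $R^{i}_{~k}=2\frac{\partial G^{i}}{\partial x^{k}}-y^{j}\frac{\partial^{2} G^{i}}{\partial x^{j}\partial y^{k}}+2G^{j}\frac{\partial^{2} G^{i}}{\partial y^{j}\partial y^{k}}-\frac{\partial G^{i}}{\partial y^{s}}\frac{\partial G^{s}}{\partial y^{k}}$; Ricci curvature $\mathbf{Ric}_{G}=R^m_{~m}$; Ricci scalar $R=\frac{1}{n-1}\mathbf{Ric}_G$; $T^i_{~k}=R^i_{~k}-(R\delta^i_k-\frac12R_{\cdot k}y^i)$; $\chi_k=-\frac13T^m_{~k\cdot m}$. For a volume form $dV=\sigma(x)dx^1\cdots dx^n$ ($\sigma>0$), the S-curvature of $(\mathbf{G},dV)$ is $\mathbf{S}=\frac{\partial G^m}{\partial y^m}-y^m\frac{\partial}{\partial x^m}(\ln\sigma)$. The associated projective spray is $\hat{\mathbf{G}}=\mathbf{G}+\frac{2\mathbf{S}}{n+1}\mathbf{Y}$, $\mathbf{Y}=y^i\frac{\partial}{\partial y^i}$, i.e. $\hat G^i=G^i-\frac{\mathbf{S}}{n+1}y^i$. Let $\hat R=\frac1{n-1}\mathbf{Ric}_{\hat G}$ be the Ricci scalar of $\hat{\mathbf{G}}$, and let $\parallel$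 denote the horizontal covariant derivative with respect to $\hat{\mathbf{G}}$ (defined as $|$ with $\hat G^i$ in place of $G^i$). The Berwald-Weyl curvature $\mathbf{W}^o=W^o_kdx^k$ of $(\mathbf{G},dV)$ is $W^o_k=\hat R_{\parallel k}-\frac12\hat R_{\cdot k\parallel m}y^m$. *)

theory Defs
  imports "HOL-Analysis.Analysis"
begin

section \<open>Smooth maps and smooth manifolds\<close>

text \<open>Both notions are meant for open sets \<open>S\<close> of a finite-dimensional space, where it
  suffices to iterate directional derivatives of Frechet differentiable maps.\<close>

primrec Ck_on :: "nat \<Rightarrow> 'a::euclidean_space set \<Rightarrow> ('a \<Rightarrow> 'b::real_normed_vector) \<Rightarrow> bool" where
  "Ck_on 0 S f \<longleftrightarrow> continuous_on S f"
| "Ck_on (Suc k) S f \<longleftrightarrow>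
     (\<forall>x\<in>S. f differentiable (at x)) \<and> (\<forall>v. Ck_on k S (\<lambda>x. frechet_derivative f (at x) v))"

definition smooth_map_on :: "'a::euclidean_space set \<Rightarrow> ('a \<Rightarrow> 'b::real_normed_vector) \<Rightarrow> bool" where
  "smooth_map_on S f \<longleftrightarrow> (\<forall>k. Ck_on k S f)"

text \<open>A chart is a pair of a domain and a coordinate map; the values of the coordinate map
  outside of the domain are irrelevant.\<close>

type_synonym ('a, 'n) chart = "'a set \<times> ('a \<Rightarrow> real ^ 'n)"

definition chart_on :: "'a topology \<Rightarrow> ('a, 'n::finite) chart \<Rightarrow> bool" where
  "chart_on M c \<longleftrightarrow> openin M (fst c) \<and> open (snd c ` fst c) \<and>
     homeomorphic_map (subtopology M (fst c)) (top_of_set (snd c ` fst c)) (snd c)"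

definition coord_domain :: "('a, 'n::finite) chart \<Rightarrow> (real ^ 'n) set" where
  "coord_domain c = snd c ` fst c"

definition overlap :: "('a, 'n::finite) chart \<Rightarrow> ('a, 'n) chart \<Rightarrow> (real ^ 'n) set" where
  "overlap c c' = snd c ` (fst c \<inter> fst c')"

definition transition :: "('a, 'n::finite) chart \<Rightarrow> ('a, 'n) chart \<Rightarrow> real ^ 'n \<Rightarrow> real ^ 'n" where
  "transition c c' x = snd c' (inv_into (fst c) (snd c) x)"

text \<open>The atlas need not be maximal; the dimension is \<open>CARD('n)\<close>.\<close>

definition smooth_manifold :: "'a topology \<Rightarrow> ('a, 'n::finite) chart set \<Rightarrow> bool" where
  "smooth_manifold M A \<longleftrightarrow>
     Hausdorff_space M \<and> second_countable M \<and>
     (\<forall>c\<in>A. chart_on M c) \<and> (\<Union>c\<in>A. fst c) = topspace M \<and>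
     (\<forall>c\<in>A. \<forall>c'\<in>A. smooth_map_on (overlap c c') (transition c c'))"


section \<open>Objects on the slit tangent bundle\<close>

text \<open>A point of the coordinate domain of \<open>TM\<close> induced by a chart is a pair \<open>(x, y)\<close>.
  The change of these coordinates is \<open>(x, y) \<mapsto> (\<psi> x, D\<psi>(x) y)\<close>, where \<open>\<psi>\<close> is the transition
  map. Functions and vector fields on \<open>TM\<close> without its zero section, and volume forms on \<open>M\<close>,
  are given by their local expressions in the charts of the atlas, subject to the respective
  transformation rule on overlaps.\<close>

definition slit :: "(real ^ 'n) set \<Rightarrow> ((real ^ 'n::finite) \<times> (real ^ 'n)) set" where
  "slit D = D \<times> (- {0})"

definition tangent_map ::
    "(real ^ 'n \<Rightarrow> real ^ 'n) \<Rightarrow> (real ^ 'n::finite) \<times> (real ^ 'n) \<Rightarrow> (real ^ 'n) \<times> (real ^ 'n)" where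
  "tangent_map \<psi> z = (\<psi> (fst z), frechet_derivative \<psi> (at (fst z)) (snd z))"

type_synonym ('a, 'n) tm_function =
  "('a, 'n) chart \<Rightarrow> (real ^ 'n) \<times> (real ^ 'n) \<Rightarrow> real"

type_synonym ('a, 'n) tm_vector_field =
  "('a, 'n) chart \<Rightarrow> (real ^ 'n) \<times> (real ^ 'n) \<Rightarrow> (real ^ 'n) \<times> (real ^ 'n)"

definition function_on_TM0 :: "('a, 'n::finite) chart set \<Rightarrow> ('a, 'n) tm_function \<Rightarrow> bool" where
  "function_on_TM0 A P \<longleftrightarrow>
     (\<forall>c\<in>A. \<forall>c'\<in>A. \<forall>z\<in>slit (overlap c c'). P c' (tangent_map (transition c c') z) = P c z)"

definition smooth_vector_field_on_TM0 ::
    "('a, 'n::finite) chart set \<Rightarrow> ('a, 'n) tm_vector_field \<Rightarrow> bool" where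
  "smooth_vector_field_on_TM0 A V \<longleftrightarrow>
     (\<forall>c\<in>A. smooth_map_on (slit (coord_domain c)) (V c)) \<and>
     (\<forall>c\<in>A. \<forall>c'\<in>A. \<forall>z\<in>slit (overlap c c').
        V c' (tangent_map (transition c c') z) =
          frechet_derivative (tangent_map (transition c c')) (at z) (V c z))"

text \<open>The coefficients \<open>G\<^sup>i\<close> of \<open>y\<^sup>i \<partial>/\<partial>x\<^sup>i - 2 G\<^sup>i \<partial>/\<partial>y\<^sup>i\<close>.\<close>

definition coeff_of ::
    "('a, 'n::finite) tm_vector_field \<Rightarrow> ('a, 'n) chart \<Rightarrow> 'n \<Rightarrow> (real ^ 'n) \<times> (real ^ 'n) \<Rightarrow> real" where
  "coeff_of V c i z = - (1/2) * snd (V c z) $ i"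

definition spray :: "('a, 'n::finite) chart set \<Rightarrow> ('a, 'n) tm_vector_field \<Rightarrow> bool" where
  "spray A V \<longleftrightarrow> smooth_vector_field_on_TM0 A V \<and>
     (\<forall>c\<in>A. \<forall>(x, y)\<in>slit (coord_domain c).
        fst (V c (x, y)) = y \<and>
        (\<forall>i. \<forall>r>0. coeff_of V c i (x, r *\<^sub>R y) = r\<^sup>2 * coeff_of V c i (x, y)))"

definition projectively_equivalent ::
    "('a, 'n::finite) chart set \<Rightarrow> ('a, 'n) tm_vector_field \<Rightarrow> ('a, 'n) tm_vector_field \<Rightarrow> bool" where
  "projectively_equivalent A V V' \<longleftrightarrow>
     (\<exists>P. function_on_TM0 A P \<and>
        (\<forall>c\<in>A. \<forall>(x, y)\<in>slit (coord_domain c).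
           (\<forall>r>0. P c (x, r *\<^sub>R y) = r * P c (x, y)) \<and>
           (\<forall>i. coeff_of V' c i (x, y) = coeff_of V c i (x, y) + P c (x, y) * y $ i)))"

text \<open>\<open>dV = \<sigma> dx\<^sup>1 \<dots> dx\<^sup>n\<close> with \<open>\<sigma> > 0\<close> in every chart, i.e. a positive smooth density; this is
  why the Jacobian enters with its absolute value. On an oriented atlas these are exactly the
  positive top-degree forms.\<close>

definition volume_form ::
    "('a, 'n::finite) chart set \<Rightarrow> (('a, 'n) chart \<Rightarrow> real ^ 'n \<Rightarrow> real) \<Rightarrow> bool" where
  "volume_form A \<sigma> \<longleftrightarrow>
     (\<forall>c\<in>A. smooth_map_on (coord_domain c) (\<sigma> c) \<and> (\<forall>x\<in>coord_domain c. \<sigma> c x > 0)) \<and>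
     (\<forall>c\<in>A. \<forall>c'\<in>A. \<forall>x\<in>overlap c c'.
        \<sigma> c x = \<bar>det (matrix (frechet_derivative (transition c c') (at x)))\<bar> * \<sigma> c' (transition c c' x))"


section \<open>Curvatures in local coordinates\<close>

definition pdx :: "'n \<Rightarrow> ((real ^ 'n::finite) \<times> (real ^ 'n) \<Rightarrow> real) \<Rightarrow> (real ^ 'n) \<times> (real ^ 'n) \<Rightarrow> real" where
  "pdx k f z = frechet_derivative f (at z) (axis k 1, 0)"

definition pdy :: "'n \<Rightarrow> ((real ^ 'n::finite) \<times> (real ^ 'n) \<Rightarrow> real) \<Rightarrow> (real ^ 'n) \<times> (real ^ 'n) \<Rightarrow> real" where
  "pdy k f z = frechet_derivative f (at z) (0, axis k 1)"

text \<open>In the rest of this section \<open>G\<close> is the family of coefficients of a spray in one chart.\<close>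

type_synonym 'n coeffs = "'n \<Rightarrow> (real ^ 'n) \<times> (real ^ 'n) \<Rightarrow> real"

definition nonlin_conn :: "'n::finite coeffs \<Rightarrow> 'n \<Rightarrow> 'n \<Rightarrow> (real ^ 'n) \<times> (real ^ 'n) \<Rightarrow> real" where
  "nonlin_conn G i j = pdy j (G i)"

definition berwald_conn ::
    "'n::finite coeffs \<Rightarrow> 'n \<Rightarrow> 'n \<Rightarrow> 'n \<Rightarrow> (real ^ 'n) \<times> (real ^ 'n) \<Rightarrow> real" where
  "berwald_conn G i j k = pdy j (pdy k (G i))"

definition hderiv ::
    "'n::finite coeffs \<Rightarrow> ((real ^ 'n) \<times> (real ^ 'n) \<Rightarrow> real) \<Rightarrow> 'n \<Rightarrow> (real ^ 'n) \<times> (real ^ 'n) \<Rightarrow> real" where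
  "hderiv G f k z = pdx k f z - (\<Sum>l\<in>UNIV. nonlin_conn G l k z * pdy l f z)"

text \<open>\<open>A\<^sub>k\<^sub>|\<^sub>m\<close> for a family \<open>A\<close> of covector components.\<close>

definition hderiv_covector ::
    "'n::finite coeffs \<Rightarrow> ('n \<Rightarrow> (real ^ 'n) \<times> (real ^ 'n) \<Rightarrow> real) \<Rightarrow> 'n \<Rightarrow> 'n \<Rightarrow> (real ^ 'n) \<times> (real ^ 'n) \<Rightarrow> real" where
  "hderiv_covector G A k m z = hderiv G (A k) m z - (\<Sum>l\<in>UNIV. berwald_conn G l k m z * A l z)"

definition riemann_curv ::
    "'n::finite coeffs \<Rightarrow> 'n \<Rightarrow> 'n \<Rightarrow> (real ^ 'n) \<times> (real ^ 'n) \<Rightarrow> real" where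
  "riemann_curv G i k z =
     2 * pdx k (G i) z
     - (\<Sum>j\<in>UNIV. snd z $ j * pdx j (pdy k (G i)) z)
     + 2 * (\<Sum>j\<in>UNIV. G j z * pdy j (pdy k (G i)) z)
     - (\<Sum>s\<in>UNIV. pdy s (G i) z * pdy k (G s) z)"

definition ricci_curv :: "'n::finite coeffs \<Rightarrow> (real ^ 'n) \<times> (real ^ 'n) \<Rightarrow> real" where
  "ricci_curv G z = (\<Sum>m\<in>UNIV. riemann_curv G m m z)"

definition ricci_scalar :: "'n::finite coeffs \<Rightarrow> (real ^ 'n) \<times> (real ^ 'n) \<Rightarrow> real" where
  "ricci_scalar G z = 1 / (real CARD('n) - 1) * ricci_curv G z"

definition T_curv :: "'n::finite coeffs \<Rightarrow> 'n \<Rightarrow> 'n \<Rightarrow> (real ^ 'n) \<times> (real ^ 'n) \<Rightarrow> real" where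
  "T_curv G i k z = riemann_curv G i k z
     - (ricci_scalar G z * (if i = k then 1 else 0) - 1/2 * pdy k (ricci_scalar G) z * snd z $ i)"

definition chi_curv :: "'n::finite coeffs \<Rightarrow> 'n \<Rightarrow> (real ^ 'n) \<times> (real ^ 'n) \<Rightarrow> real" where
  "chi_curv G k z = - (1/3) * (\<Sum>m\<in>UNIV. pdy m (T_curv G m k) z)"

definition S_curv ::
    "'n::finite coeffs \<Rightarrow> (real ^ 'n \<Rightarrow> real) \<Rightarrow> (real ^ 'n) \<times> (real ^ 'n) \<Rightarrow> real" where
  "S_curv G \<sigma> z = (\<Sum>m\<in>UNIV. pdy m (G m) z)
     - (\<Sum>m\<in>UNIV. snd z $ m * frechet_derivative (\<lambda>x. ln (\<sigma> x)) (at (fst z)) (axis m 1))"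


section \<open>The Berwald--Weyl curvature\<close>

definition projective_spray ::
    "('a, 'n::finite) tm_vector_field \<Rightarrow> (('a, 'n) chart \<Rightarrow> real ^ 'n \<Rightarrow> real) \<Rightarrow> ('a, 'n) tm_vector_field" where
  "projective_spray V \<sigma> c z =
     V c z + (2 * S_curv (coeff_of V c) (\<sigma> c) z / (real CARD('n) + 1)) *\<^sub>R (0, snd z)"

text \<open>The components \<open>W\<^sup>o\<^sub>k\<close> in the chart \<open>c\<close> at the point with coordinates \<open>z = (x, y)\<close>.\<close>

definition berwald_weyl ::
    "('a, 'n::finite) tm_vector_field \<Rightarrow> (('a, 'n) chart \<Rightarrow> real ^ 'n \<Rightarrow> real) \<Rightarrow>
     ('a, 'n) chart \<Rightarrow> 'n \<Rightarrow> (real ^ 'n) \<times> (real ^ 'n) \<Rightarrow> real" where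
  "berwald_weyl V \<sigma> c k z =
     (let H = coeff_of (projective_spray V \<sigma>) c; R = ricci_scalar H
      in hderiv H R k z
         - 1/2 * (\<Sum>m\<in>UNIV. hderiv_covector H (\<lambda>j. pdy j R) k m z * snd z $ m))"

end

theory Submission
  imports Defs
begin


text \<open>Everything happens in one chart. Write \<open>f\<^sub>\<bar>\<^sub>0\<close> for the derivative \<open>f\<^sub>\<bar>\<^sub>m y\<^sup>m\<close> along the spray and
consider a projective change \<open>H\<^sup>i = G\<^sup>i + P y\<^sup>i\<close> with a positively homogeneous \<open>P\<close> of degree one. Its
Ricci scalar is \<open>R + P\<^sup>2 - P\<^sub>\<bar>\<^sub>0\<close>. Put this into \<open>W\<^sub>k(R) = R\<^sub>\<bar>\<^sub>k - 1/2 R\<^sub>.\<^sub>k\<^sub>\<bar>\<^sub>0\<close>, formed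
with \<open>H\<close>, and express all derivatives by those of \<open>G\<close>. With \<open>B\<^sub>k = P\<^sub>\<bar>\<^sub>k - P\<^sub>.\<^sub>k\<^sub>\<bar>\<^sub>0\<close> the result is

  \<open>W\<^sub>k(R) + 3/2 P B\<^sub>k - 1/2 B\<^sub>k\<^sub>\<bar>\<^sub>0 + (P\<^sub>\<bar>\<^sub>k\<^sub>\<bar>\<^sub>0 - P\<^sub>\<bar>\<^sub>0\<^sub>\<bar>\<^sub>k) + 1/2 P R\<^sub>.\<^sub>k - R P\<^sub>.\<^sub>k\<close>.

The term in parentheses is the commutator of the spray with a horizontal derivative, hence \<open>R\<^sup>l\<^sub>k P\<^sub>.\<^sub>l\<close>
(\<open>horizontal_commutator\<close>). This is where dimension two enters: there
\<open>R\<^sup>l\<^sub>k = R \<delta>\<^sup>l\<^sub>k - 1/2 R\<^sub>.\<^sub>k y\<^sup>l - \<chi>\<^sub>k y\<^sup>l\<close> (\<open>riemann_curv_surface\<close>), so it cancels the last two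
terms and leaves \<open>- \<chi>\<^sub>k P\<close>.

The associated projective spray is the case \<open>P = - S/3\<close>. Since \<open>\<chi>\<^sub>k = 1/2 (S\<^sub>.\<^sub>k\<^sub>\<bar>\<^sub>0 - S\<^sub>\<bar>\<^sub>k)\<close>
(\<open>chi_curv_S_curv\<close>), one gets \<open>B\<^sub>k = 2/3 \<chi>\<^sub>k\<close>. The terms with \<open>P\<close> cancel and what remains is
\<open>W\<^sub>k(R) - 1/3 \<chi>\<^sub>k\<^sub>\<bar>\<^sub>0\<close> (\<open>weyl_projective_change\<close>), which is the formula.

The formula does not mention the volume form, which gives independence of it. For projective invariance
the two sprays may therefore be compared with the same volume form. If \<open>G' = G + P y\<close>, the
S-curvatures differ by \<open>3 P\<close>, so both sprays have the same associated projective spray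
(\<open>berwald_weyl_projectively_invariant\<close>).\<close>

section \<open>Calculus of smooth functions on an open set\<close>

definition dirderiv :: "'a::euclidean_space \<Rightarrow> ('a \<Rightarrow> 'b::real_normed_vector) \<Rightarrow> 'a \<Rightarrow> 'b" where
  "dirderiv v f z = frechet_derivative f (at z) v"

lemma has_derivative_dirderiv:
  "f differentiable (at z) \<Longrightarrow> (f has_derivative (\<lambda>v. dirderiv v f z)) (at z)"
  by (simp add: dirderiv_def[abs_def] frechet_derivative_works)

lemma dirderiv_eqI: "(f has_derivative f') (at z) \<Longrightarrow> dirderiv v f z = f' v"
  by (metis dirderiv_def frechet_derivative_at)

lemma dirderiv_cong:
  assumes "open U" "z \<in> U" "\<And>w. w \<in> U \<Longrightarrow> f w = g w"
  shows "dirderiv v f z = dirderiv v g z"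
proof -
  have "(f has_derivative f') (at z) \<longleftrightarrow> (g has_derivative f') (at z)" for f'
    using assms has_derivative_transform_within_open by (metis (no_types, lifting))
  then show ?thesis by (simp add: dirderiv_def frechet_derivative_def)
qed

lemma differentiable_cong_open:
  assumes "open U" "z \<in> U" "\<And>w. w \<in> U \<Longrightarrow> f w = g w" "f differentiable (at z)"
  shows "g differentiable (at z)"
  using assms has_derivative_transform_within_open unfolding differentiable_def by metis

lemma Ck_on_Suc_dirderiv:
  "Ck_on (Suc k) U f \<longleftrightarrow> (\<forall>x\<in>U. f differentiable (at x)) \<and> (\<forall>v. Ck_on k U (dirderiv v f))"
  by (simp add: dirderiv_def[abs_def])

declare Ck_on.simps(2) [simp del]

lemma Ck_on_cong:
  assumes "open U" "\<And>w. w \<in> U \<Longrightarrow> f w = g w" "Ck_on k U f"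
  shows "Ck_on k U g"
  using assms(2,3)
proof (induction k arbitrary: f g)
  case 0
  then show ?case by (simp cong: continuous_on_cong)
next
  case (Suc k)
  have "Ck_on k U (dirderiv v g)" for v
    by (rule Suc.IH[of "dirderiv v f"]) (use Suc.prems in \<open>auto simp: Ck_on_Suc_dirderiv intro!: dirderiv_cong[OF assms(1)]\<close>)
  moreover have "\<forall>x\<in>U. g differentiable (at x)"
    using differentiable_cong_open[OF assms(1) _ Suc.prems(1)] Suc.prems(2) by (simp add: Ck_on_Suc_dirderiv)
  ultimately show ?case unfolding Ck_on_Suc_dirderiv by blast
qed

lemma Ck_on_Suc_imp: "Ck_on (Suc k) U f \<Longrightarrow> Ck_on k U f"
proof (induction k arbitrary: f)
  case 0
  then show ?case
    by (auto simp: Ck_on_Suc_dirderiv intro!: differentiable_imp_continuous_on differentiable_at_imp_differentiable_on)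
next
  case (Suc k)
  have "Ck_on k U (dirderiv v f)" for v
    by (rule Suc.IH) (use Suc.prems in \<open>simp add: Ck_on_Suc_dirderiv\<close>)
  then show ?case using Suc.prems unfolding Ck_on_Suc_dirderiv by blast
qed

lemma Ck_on_const: "Ck_on k U (\<lambda>_. c)"
  by (induction k arbitrary: c) (auto simp: Ck_on.simps(2))

lemma dirderiv_add:
  assumes "f differentiable (at z)" "g differentiable (at z)"
  shows "dirderiv v (\<lambda>z. f z + g z) z = dirderiv v f z + dirderiv v g z"
  by (rule dirderiv_eqI[OF has_derivative_add[OF assms[THEN has_derivative_dirderiv]]])

lemma Ck_on_add:
  assumes "open U" "Ck_on k U f" "Ck_on k U g"
  shows "Ck_on k U (\<lambda>z. f z + g z)"
  using assms(2,3)
proof (induction k arbitrary: f g)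
  case 0
  then show ?case by (auto intro: continuous_intros)
next
  case (Suc k)
  have "Ck_on k U (dirderiv v (\<lambda>z. f z + g z))" for v
    by (rule Ck_on_cong[OF assms(1), of "\<lambda>z. dirderiv v f z + dirderiv v g z"])
      (use Suc in \<open>auto simp: Ck_on_Suc_dirderiv dirderiv_add\<close>)
  then show ?case using Suc.prems by (auto simp: Ck_on_Suc_dirderiv)
qed

lemma dirderiv_mult:
  fixes f g :: "'a::euclidean_space \<Rightarrow> real"
  assumes "f differentiable (at z)" "g differentiable (at z)"
  shows "dirderiv v (\<lambda>z. f z * g z) z = dirderiv v f z * g z + f z * dirderiv v g z"
  by (simp add: dirderiv_eqI[OF has_derivative_mult[OF assms[THEN has_derivative_dirderiv]]])

lemma Ck_on_mult:
  fixes f g :: "'a::euclidean_space \<Rightarrow> real"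
  assumes "open U" "Ck_on k U f" "Ck_on k U g"
  shows "Ck_on k U (\<lambda>z. f z * g z)"
  using assms(2,3)
proof (induction k arbitrary: f g)
  case 0
  then show ?case by (auto intro: continuous_intros)
next
  case (Suc k)
  have "Ck_on k U (dirderiv v (\<lambda>z. f z * g z))" for v
    by (rule Ck_on_cong[OF assms(1), of "\<lambda>z. dirderiv v f z * g z + f z * dirderiv v g z"])
      (use Suc Suc.prems[THEN Ck_on_Suc_imp] in \<open>auto simp: Ck_on_Suc_dirderiv dirderiv_mult intro!: Ck_on_add[OF assms(1)]\<close>)
  then show ?case using Suc.prems by (auto simp: Ck_on_Suc_dirderiv)
qed

lemma Ck_on_minus:
  fixes f :: "'a::euclidean_space \<Rightarrow> real"
  assumes "open U" "Ck_on k U f"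
  shows "Ck_on k U (\<lambda>z. - f z)"
  using Ck_on_mult[OF assms(1) Ck_on_const assms(2), of "-1"] by simp

lemma dirderiv_inverse:
  fixes f :: "'a::euclidean_space \<Rightarrow> real"
  assumes "f differentiable (at z)" "f z \<noteq> 0"
  shows "dirderiv v (\<lambda>z. inverse (f z)) z = - (inverse (f z) * dirderiv v f z * inverse (f z))"
  by (rule dirderiv_eqI[OF Deriv.has_derivative_inverse[OF assms(2) has_derivative_dirderiv[OF assms(1)]]])

text \<open>By the quotient rule the derivative of \<open>1/f\<close> is a product of a derivative of \<open>f\<close> and two copies of \<open>1/f\<close>, so
one order of differentiability is gained from the previous one.\<close>

lemma Ck_on_inverse:
  fixes f :: "'a::euclidean_space \<Rightarrow> real"
  assumes "open U" "Ck_on k U f" "\<And>z. z \<in> U \<Longrightarrow> f z \<noteq> 0"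
  shows "Ck_on k U (\<lambda>z. inverse (f z))"
  using assms(2)
proof (induction k)
  case 0
  then show ?case using assms(3) by (auto intro!: continuous_intros)
next
  case (Suc k)
  have IH: "Ck_on k U (\<lambda>z. inverse (f z))" by (rule Suc.IH[OF Ck_on_Suc_imp[OF Suc.prems]])
  have dif: "\<forall>x\<in>U. f differentiable (at x)" and ck: "Ck_on k U (dirderiv v f)" for v
    using Suc.prems by (auto simp: Ck_on_Suc_dirderiv)
  have "Ck_on k U (dirderiv v (\<lambda>z. inverse (f z)))" for v
    by (rule Ck_on_cong[OF assms(1), of "\<lambda>z. - (inverse (f z) * dirderiv v f z * inverse (f z))"])
      (use dif assms(3) in \<open>auto simp: dirderiv_inverse intro!: Ck_on_minus[OF assms(1)] Ck_on_mult[OF assms(1)] IH ck Ck_on_const\<close>)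
  moreover have "\<forall>x\<in>U. (\<lambda>z. inverse (f z)) differentiable (at x)"
    using dif assms(3) by (auto intro!: differentiable_inverse)
  ultimately show ?case unfolding Ck_on_Suc_dirderiv by blast
qed

lemma Ck_on_ln:
  fixes f :: "'a::euclidean_space \<Rightarrow> real"
  assumes "open U" "Ck_on k U f" "\<And>z. z \<in> U \<Longrightarrow> f z > 0"
  shows "Ck_on k U (\<lambda>z. ln (f z))"
proof (cases k)
  case 0
  then show ?thesis using assms(2,3) by (force intro!: continuous_intros)
next
  case (Suc j)
  have dif: "\<forall>x\<in>U. f differentiable (at x)" and ck: "Ck_on j U (dirderiv v f)" for v
    using assms(2) Suc by (auto simp: Ck_on_Suc_dirderiv)
  have inv: "Ck_on j U (\<lambda>z. inverse (f z))"
    by (rule Ck_on_inverse[OF assms(1)]) (use assms(2,3) Suc Ck_on_Suc_imp in fastforce)+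
  have D: "((\<lambda>z. ln (f z)) has_derivative (\<lambda>v. dirderiv v f z * inverse (f z))) (at z)" if "z \<in> U" for z
    using dif assms(3)[OF that] that
    by (auto intro!: derivative_eq_intros has_derivative_dirderiv simp: field_simps)
  have "Ck_on j U (dirderiv v (\<lambda>z. ln (f z)))" for v
    by (rule Ck_on_cong[OF assms(1), of "\<lambda>z. dirderiv v f z * inverse (f z)"])
      (auto simp: dirderiv_eqI[OF D] intro!: Ck_on_mult[OF assms(1)] inv ck)
  moreover have "\<forall>x\<in>U. (\<lambda>z. ln (f z)) differentiable (at x)"
    using D differentiable_def by blast
  ultimately show ?thesis unfolding Suc unfolding Ck_on_Suc_dirderiv by blast
qed

lemma Ck_on_bounded_linear:
  assumes "open U" "bounded_linear L" "Ck_on k U f"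
  shows "Ck_on k U (\<lambda>z. L (f z))"
  using assms(3)
proof (induction k arbitrary: f)
  case 0
  then show ?case using assms(2) by (auto intro: bounded_linear.continuous_on)
next
  case (Suc k)
  have D: "((\<lambda>z. L (f z)) has_derivative (\<lambda>v. L (dirderiv v f z))) (at z)" if "z \<in> U" for z
    using Suc.prems that
    by (auto intro!: bounded_linear.has_derivative[OF assms(2)] has_derivative_dirderiv simp: Ck_on_Suc_dirderiv)
  have "Ck_on k U (dirderiv v (\<lambda>z. L (f z)))" for v
    by (rule Ck_on_cong[OF assms(1), of "\<lambda>z. L (dirderiv v f z)"])
      (use Suc in \<open>auto simp: dirderiv_eqI[OF D] Ck_on_Suc_dirderiv\<close>)
  moreover have "\<forall>x\<in>U. (\<lambda>z. L (f z)) differentiable (at x)"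
    using D differentiable_def by blast
  ultimately show ?case unfolding Ck_on_Suc_dirderiv by blast
qed

lemma Ck_on_ident: "Ck_on k U (\<lambda>z. z)"
  by (cases k) (auto simp: Ck_on.simps(2) Ck_on_const)

lemma Ck_on_fst:
  assumes "open U" "fst ` U \<subseteq> D" "Ck_on k D f"
  shows "Ck_on k U (\<lambda>z. f (fst z))"
  using assms(3)
proof (induction k arbitrary: f)
  case 0
  then show ?case using assms(2) by (auto intro: continuous_on_compose2[OF _ continuous_on_fst[OF continuous_on_id]])
next
  case (Suc k)
  have D: "((\<lambda>z. f (fst z)) has_derivative (\<lambda>v. dirderiv (fst v) f (fst z))) (at z)" if "z \<in> U" for z
    using Suc.prems assms(2) that
    by (auto intro!: has_derivative_compose[OF has_derivative_fst[OF has_derivative_ident], of f] has_derivative_dirderiv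
          simp: Ck_on_Suc_dirderiv)
  have "Ck_on k U (dirderiv v (\<lambda>z. f (fst z)))" for v
    by (rule Ck_on_cong[OF assms(1), of "\<lambda>z. dirderiv (fst v) f (fst z)"])
      (use Suc in \<open>auto simp: dirderiv_eqI[OF D] Ck_on_Suc_dirderiv\<close>)
  moreover have "\<forall>x\<in>U. (\<lambda>z. f (fst z)) differentiable (at x)"
    using D differentiable_def by blast
  ultimately show ?case unfolding Ck_on_Suc_dirderiv by blast
qed

lemma dirderiv_fst:
  assumes "f differentiable (at (fst z))"
  shows "dirderiv v (\<lambda>z. f (fst z)) z = dirderiv (fst v) f (fst z)"
  by (rule dirderiv_eqI[OF has_derivative_compose[OF has_derivative_fst[OF has_derivative_ident] has_derivative_dirderiv[OF assms]]])

text \<open>The second difference of \<open>f\<close> over a small parallelogram is a mixed derivative at an intermediate point: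
the mean value theorem is applied first along \<open>v\<close>, to the difference of \<open>f\<close> over two parallel sides,
and then along \<open>w\<close>.\<close>

lemma second_difference_mvt:
  fixes f :: "'a::euclidean_space \<Rightarrow> real"
  assumes sub: "ball z e \<subseteq> U" and h: "h > 0" "h * (norm v + norm w) < e"
    and f: "\<And>x. x \<in> U \<Longrightarrow> f differentiable (at x)"
    and f': "\<And>x. x \<in> U \<Longrightarrow> dirderiv v f differentiable (at x)"
  shows "\<exists>p\<in>ball z e. f (z + h *\<^sub>R v + h *\<^sub>R w) - f (z + h *\<^sub>R v) - f (z + h *\<^sub>R w) + f z
           = h * h * dirderiv w (dirderiv v f) p"
proof -
  have inb: "z + s *\<^sub>R v + t *\<^sub>R w \<in> ball z e" if "s \<in> {0..h}" "t \<in> {0..h}" for s t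
  proof -
    have "norm (s *\<^sub>R v + t *\<^sub>R w) \<le> s * norm v + t * norm w"
      using that by (intro order.trans[OF norm_triangle_ineq]) auto
    also have "\<dots> \<le> h * norm v + h * norm w"
      using that by (intro add_mono mult_right_mono) auto
    finally show ?thesis using h(2) by (simp add: dist_norm algebra_simps norm_minus_commute)
  qed
  have inU: "z + s *\<^sub>R v + t *\<^sub>R w \<in> U" if "s \<in> {0..h}" "t \<in> {0..h}" for s t
    using inb[OF that] sub by blast
  define g where "g s = f (z + s *\<^sub>R v + h *\<^sub>R w) - f (z + s *\<^sub>R v + 0 *\<^sub>R w)" for s
  have line1: "((\<lambda>s. f (z + s *\<^sub>R v + t *\<^sub>R w)) has_real_derivative
           dirderiv v f (z + s *\<^sub>R v + t *\<^sub>R w)) (at s)" if "s \<in> {0..h}" "t \<in> {0..h}" for s t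
  proof -
    let ?F = "\<lambda>u. dirderiv u f (z + s *\<^sub>R v + t *\<^sub>R w)"
    have F: "(f has_derivative ?F) (at (z + s *\<^sub>R v + t *\<^sub>R w))"
      using has_derivative_dirderiv f inU that by blast
    have "((\<lambda>s. f (z + s *\<^sub>R v + t *\<^sub>R w)) has_derivative (\<lambda>r. ?F (r *\<^sub>R v))) (at s)"
      by (rule has_derivative_compose[where f = "\<lambda>s. z + s *\<^sub>R v + t *\<^sub>R w" and g = f, OF _ F]) (auto intro!: derivative_eq_intros)
    moreover have "?F (r *\<^sub>R v) = ?F v * r" for r
      using linear_cmul[OF has_derivative_linear[OF F], of r v] by (simp add: mult.commute)
    ultimately show ?thesis by (simp add: has_field_derivative_def)
  qed
  have line2: "((\<lambda>t. dirderiv v f (z + s *\<^sub>R v + t *\<^sub>R w)) has_real_derivative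
           dirderiv w (dirderiv v f) (z + s *\<^sub>R v + t *\<^sub>R w)) (at t)" if "s \<in> {0..h}" "t \<in> {0..h}" for s t
  proof -
    let ?F = "\<lambda>u. dirderiv u (dirderiv v f) (z + s *\<^sub>R v + t *\<^sub>R w)"
    have F: "(dirderiv v f has_derivative ?F) (at (z + s *\<^sub>R v + t *\<^sub>R w))"
      using has_derivative_dirderiv f' inU that by blast
    have "((\<lambda>t. dirderiv v f (z + s *\<^sub>R v + t *\<^sub>R w)) has_derivative (\<lambda>r. ?F (r *\<^sub>R w))) (at t)"
      by (rule has_derivative_compose[where f = "\<lambda>t. z + s *\<^sub>R v + t *\<^sub>R w" and g = "dirderiv v f", OF _ F]) (auto intro!: derivative_eq_intros)
    moreover have "?F (r *\<^sub>R w) = ?F w * r" for r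
      using linear_cmul[OF has_derivative_linear[OF F], of r w] by (simp add: mult.commute)
    ultimately show ?thesis by (simp add: has_field_derivative_def)
  qed
  have "\<exists>s>0. s < h \<and> g h - g 0 = (h - 0) * (dirderiv v f (z + s *\<^sub>R v + h *\<^sub>R w) - dirderiv v f (z + s *\<^sub>R v + 0 *\<^sub>R w))"
    unfolding g_def by (rule MVT2[OF h(1)]) (use h(1) in \<open>auto intro!: DERIV_diff line1 simp del: scaleR_zero_left\<close>)
  then obtain s where s: "0 < s" "s < h"
    and gs: "g h - g 0 = h * (dirderiv v f (z + s *\<^sub>R v + h *\<^sub>R w) - dirderiv v f (z + s *\<^sub>R v + 0 *\<^sub>R w))"
    by auto
  have "\<exists>t>0. t < h \<and> dirderiv v f (z + s *\<^sub>R v + h *\<^sub>R w) - dirderiv v f (z + s *\<^sub>R v + 0 *\<^sub>R w)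
           = (h - 0) * dirderiv w (dirderiv v f) (z + s *\<^sub>R v + t *\<^sub>R w)"
    by (rule MVT2[OF h(1)]) (use s in \<open>auto intro!: line2 simp del: scaleR_zero_left\<close>)
  then obtain t where t: "0 < t" "t < h"
    and gt: "dirderiv v f (z + s *\<^sub>R v + h *\<^sub>R w) - dirderiv v f (z + s *\<^sub>R v + 0 *\<^sub>R w)
           = h * dirderiv w (dirderiv v f) (z + s *\<^sub>R v + t *\<^sub>R w)" by auto
  have "g h - g 0 = h * h * dirderiv w (dirderiv v f) (z + s *\<^sub>R v + t *\<^sub>R w)"
    by (simp only: gs gt mult.assoc)
  moreover have "z + s *\<^sub>R v + t *\<^sub>R w \<in> ball z e" using inb s t by auto
  ultimately show ?thesis unfolding g_def by (intro bexI) auto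
qed

text \<open>Schwarz's theorem. The second difference is symmetric in \<open>v\<close> and \<open>w\<close>, so both mixed derivatives take a common
value arbitrarily close to \<open>z\<close>; by continuity they agree at \<open>z\<close>.\<close>

theorem mixed_derivatives_commute:
  fixes f :: "'a::euclidean_space \<Rightarrow> real"
  assumes "open U" "z \<in> U" and f: "Ck_on 2 U f"
  shows "dirderiv v (dirderiv w f) z = dirderiv w (dirderiv v f) z"
proof (rule ccontr)
  assume ne: "dirderiv v (dirderiv w f) z \<noteq> dirderiv w (dirderiv v f) z"
  define r where "r = \<bar>dirderiv v (dirderiv w f) z - dirderiv w (dirderiv v f) z\<bar> / 2"
  have r: "r > 0" using ne by (simp add: r_def)
  have dif: "\<And>x. x \<in> U \<Longrightarrow> f differentiable (at x)" "\<And>x u. x \<in> U \<Longrightarrow> dirderiv u f differentiable (at x)"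
    and cont: "\<And>u u'. continuous_on U (dirderiv u (dirderiv u' f))"
    using f by (auto simp: numeral_2_eq_2 Ck_on_Suc_dirderiv)
  obtain e1 where e1: "e1 > 0" "\<And>x. x \<in> U \<Longrightarrow> dist x z < e1 \<Longrightarrow> dist (dirderiv v (dirderiv w f) x) (dirderiv v (dirderiv w f) z) < r"
    using cont[of v w] assms(2) r unfolding continuous_on_iff by metis
  obtain e2 where e2: "e2 > 0" "\<And>x. x \<in> U \<Longrightarrow> dist x z < e2 \<Longrightarrow> dist (dirderiv w (dirderiv v f) x) (dirderiv w (dirderiv v f) z) < r"
    using cont[of w v] assms(2) r unfolding continuous_on_iff by metis
  obtain e3 where e3: "e3 > 0" "ball z e3 \<subseteq> U"
    using assms(1,2) open_contains_ball by metis
  define e where "e = min e1 (min e2 e3)"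
  have e: "e > 0" "ball z e \<subseteq> U" using e1 e2 e3 by (auto simp: e_def)
  define h where "h = e / (norm v + norm w + 1)"
  have nn: "norm v + norm w + 1 > 0" by (smt (verit) norm_ge_zero)
  have h: "h > 0" "h * (norm v + norm w) < e" "h * (norm w + norm v) < e"
    using e nn by (auto simp: h_def field_simps)
  obtain p where p: "p \<in> ball z e" "f (z + h *\<^sub>R v + h *\<^sub>R w) - f (z + h *\<^sub>R v) - f (z + h *\<^sub>R w) + f z
           = h * h * dirderiv w (dirderiv v f) p"
    using second_difference_mvt[OF e(2) h(1,2) dif] by blast
  obtain q where q: "q \<in> ball z e" "f (z + h *\<^sub>R w + h *\<^sub>R v) - f (z + h *\<^sub>R w) - f (z + h *\<^sub>R v) + f z
           = h * h * dirderiv v (dirderiv w f) q"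
    using second_difference_mvt[OF e(2) h(1,3) dif] by blast
  have "h * h * dirderiv w (dirderiv v f) p = h * h * dirderiv v (dirderiv w f) q"
    using p(2) q(2) by (simp add: algebra_simps)
  then have "dirderiv w (dirderiv v f) p = dirderiv v (dirderiv w f) q" using h(1) by simp
  moreover have "dist (dirderiv w (dirderiv v f) p) (dirderiv w (dirderiv v f) z) < r"
    using e2(2)[OF subsetD[OF e(2) p(1)]] p(1) by (simp add: e_def dist_commute)
  moreover have "dist (dirderiv v (dirderiv w f) q) (dirderiv v (dirderiv w f) z) < r"
    using e1(2)[OF subsetD[OF e(2) q(1)]] q(1) by (simp add: e_def dist_commute)
  ultimately have "\<bar>dirderiv v (dirderiv w f) z - dirderiv w (dirderiv v f) z\<bar> < r + r"
    unfolding dist_real_def by linarith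
  then show False by (simp add: r_def)
qed

section \<open>Partial derivatives and homogeneity on the tangent bundle\<close>

lemma smooth_map_on_dirderiv: "smooth_map_on U f \<Longrightarrow> smooth_map_on U (dirderiv v f)"
  unfolding smooth_map_on_def by (metis Ck_on_Suc_dirderiv)

lemma smooth_map_on_differentiable: "smooth_map_on U f \<Longrightarrow> z \<in> U \<Longrightarrow> f differentiable (at z)"
  unfolding smooth_map_on_def by (metis Ck_on_Suc_dirderiv)

lemma pdx_dirderiv: "pdx k f = dirderiv (axis k 1, 0) f" and pdy_dirderiv: "pdy k f = dirderiv (0, axis k 1) f"
  by (auto simp: pdx_def pdy_def dirderiv_def)

lemma pdx_const: "pdx k (\<lambda>z. c) w = 0" and pdy_const: "pdy k (\<lambda>z. c) w = 0"
  by (simp_all add: pdx_def pdy_def)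

lemma pdx_snd:
  fixes w :: "(real ^ 'n::finite) \<times> (real ^ 'n)"
  shows "pdx k (\<lambda>z. snd z $ m) w = 0"
proof -
  have "((\<lambda>z::(real^'n)\<times>(real^'n). snd z $ m) has_derivative (\<lambda>z. snd z $ m)) (at w)"
    by (intro bounded_linear_imp_has_derivative
        bounded_linear_compose[OF bounded_linear_vec_nth bounded_linear_snd])
  then show ?thesis unfolding pdx_dirderiv by (simp add: dirderiv_eqI)
qed

lemma pdy_snd:
  fixes w :: "(real ^ 'n::finite) \<times> (real ^ 'n)"
  shows "pdy k (\<lambda>z. snd z $ m) w = (if k = m then 1 else 0)"
proof -
  have "((\<lambda>z::(real^'n)\<times>(real^'n). snd z $ m) has_derivative (\<lambda>z. snd z $ m)) (at w)"
    by (intro bounded_linear_imp_has_derivative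
        bounded_linear_compose[OF bounded_linear_vec_nth bounded_linear_snd])
  then show ?thesis unfolding pdy_dirderiv by (auto simp: dirderiv_eqI axis_def)
qed

text \<open>Rules for derivatives hold only at points of the open set on which the functions are smooth. Fixing this
set once lets the simplifier apply them without having to guess it.\<close>

locale region =
  fixes U :: "((real ^ 'n::finite) \<times> (real ^ 'n)) set"
  assumes open_U: "open U"
begin

abbreviation sm :: "((real ^ 'n) \<times> (real ^ 'n) \<Rightarrow> real) \<Rightarrow> bool" where
  "sm \<equiv> smooth_map_on U"

lemma sm_const [simp]: "sm (\<lambda>z. c)"
  by (simp add: smooth_map_on_def Ck_on_const)

lemma sm_add [simp]: "sm f \<Longrightarrow> sm g \<Longrightarrow> sm (\<lambda>z. f z + g z)"
  by (simp add: smooth_map_on_def Ck_on_add open_U)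

lemma sm_mult [simp]: "sm f \<Longrightarrow> sm g \<Longrightarrow> sm (\<lambda>z. f z * g z)"
  by (simp add: smooth_map_on_def Ck_on_mult open_U)

lemma sm_minus [simp]: "sm f \<Longrightarrow> sm (\<lambda>z. - f z)"
  by (simp add: smooth_map_on_def Ck_on_minus open_U)

lemma sm_diff [simp]: "sm f \<Longrightarrow> sm g \<Longrightarrow> sm (\<lambda>z. f z - g z)"
  using sm_add[of f "\<lambda>z. - g z"] by simp

lemma sm_divide [simp]: "sm f \<Longrightarrow> sm (\<lambda>z. f z / c)"
  using sm_mult[OF _ sm_const, of f "1 / c"] by simp

lemma sm_sum [simp]: "(\<And>i. i \<in> I \<Longrightarrow> sm (f i)) \<Longrightarrow> sm (\<lambda>z. \<Sum>i\<in>I. f i z)"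
  by (induction I rule: infinite_finite_induct) auto

lemma sm_snd [simp]: "sm (\<lambda>z. snd z $ m)"
  unfolding smooth_map_on_def
  by (intro allI Ck_on_bounded_linear[OF open_U _ Ck_on_ident])
    (intro bounded_linear_compose[OF bounded_linear_vec_nth bounded_linear_snd])

lemma sm_inverse: "sm f \<Longrightarrow> (\<And>z. z \<in> U \<Longrightarrow> f z \<noteq> 0) \<Longrightarrow> sm (\<lambda>z. inverse (f z))"
  by (simp add: smooth_map_on_def Ck_on_inverse open_U)

lemma sm_pd [simp]: "sm f \<Longrightarrow> sm (pdx k f)" "sm f \<Longrightarrow> sm (pdy k f)"
  by (simp_all add: pdx_dirderiv pdy_dirderiv smooth_map_on_dirderiv)

lemma sm_cong: "sm f \<Longrightarrow> (\<And>z. z \<in> U \<Longrightarrow> f z = g z) \<Longrightarrow> sm g"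
  unfolding smooth_map_on_def using Ck_on_cong[OF open_U] by blast

lemma pd_add [simp]:
  assumes "w \<in> U" "sm f" "sm g"
  shows "pdx k (\<lambda>z. f z + g z) w = pdx k f w + pdx k g w"
    and "pdy k (\<lambda>z. f z + g z) w = pdy k f w + pdy k g w"
  using assms by (simp_all add: pdx_dirderiv pdy_dirderiv dirderiv_add smooth_map_on_differentiable)

lemma pd_mult [simp]:
  assumes "w \<in> U" "sm f" "sm g"
  shows "pdx k (\<lambda>z. f z * g z) w = pdx k f w * g w + f w * pdx k g w"
    and "pdy k (\<lambda>z. f z * g z) w = pdy k f w * g w + f w * pdy k g w"
  using assms by (simp_all add: pdx_dirderiv pdy_dirderiv dirderiv_mult smooth_map_on_differentiable)

lemma pd_minus [simp]:
  assumes "w \<in> U" "sm f"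
  shows "pdx k (\<lambda>z. - f z) w = - pdx k f w" "pdy k (\<lambda>z. - f z) w = - pdy k f w"
  using pd_mult[OF assms(1) sm_const assms(2), of k "-1"] by (simp_all add: pdx_const pdy_const)

lemma pd_divide [simp]:
  assumes "w \<in> U" "sm f"
  shows "pdx k (\<lambda>z. f z / c) w = pdx k f w / c" "pdy k (\<lambda>z. f z / c) w = pdy k f w / c"
  using pd_mult[OF assms sm_const, of k "1 / c"] by (simp_all add: pdx_const pdy_const)

lemma pd_diff [simp]:
  assumes "w \<in> U" "sm f" "sm g"
  shows "pdx k (\<lambda>z. f z - g z) w = pdx k f w - pdx k g w"
    and "pdy k (\<lambda>z. f z - g z) w = pdy k f w - pdy k g w"
  using pd_add[OF assms(1,2) sm_minus[OF assms(3)], of k] pd_minus[OF assms(1,3), of k] by simp_all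

lemma pd_sum [simp]:
  assumes "w \<in> U" "\<And>i. i \<in> I \<Longrightarrow> sm (f i)"
  shows "pdx k (\<lambda>z. \<Sum>i\<in>I. f i z) w = (\<Sum>i\<in>I. pdx k (f i) w)"
    and "pdy k (\<lambda>z. \<Sum>i\<in>I. f i z) w = (\<Sum>i\<in>I. pdy k (f i) w)"
  using assms(2) by (induction I rule: infinite_finite_induct) (auto simp: assms(1) pdx_const pdy_const)

text \<open>Derivatives depend only on the germ of a function. This is how an identity on \<open>U\<close> is differentiated.\<close>

lemma pd_cong:
  assumes "\<And>z. z \<in> U \<Longrightarrow> f z = g z" "w \<in> U"
  shows "pdx k f w = pdx k g w" "pdy k f w = pdy k g w"
  using dirderiv_cong[OF open_U assms(2), of f g] assms(1) by (simp_all add: pdx_dirderiv pdy_dirderiv)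

lemma pd_commute:
  assumes "sm f" "w \<in> U"
  shows "pdx j (pdx k f) w = pdx k (pdx j f) w"
    and "pdy j (pdx k f) w = pdx k (pdy j f) w"
    and "pdy j (pdy k f) w = pdy k (pdy j f) w"
  using assms unfolding pdx_dirderiv pdy_dirderiv smooth_map_on_def
  by (blast intro: mixed_derivatives_commute[OF open_U])+

lemma pd_commute_under:
  assumes "sm f" "w \<in> U"
  shows "pdx i (pdy j (pdx k f)) w = pdx i (pdx k (pdy j f)) w"
    and "pdy i (pdy j (pdx k f)) w = pdy i (pdx k (pdy j f)) w"
    and "pdx i (pdy j (pdy k f)) w = pdx i (pdy k (pdy j f)) w"
    and "pdy i (pdy j (pdy k f)) w = pdy i (pdy k (pdy j f)) w"
  using assms by (auto intro!: pd_cong pd_commute)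

text \<open>Homogeneity in \<open>y\<close> in the form of Euler's relation: unlike \<open>f (x, r y) = r\<^sup>d f (x, y)\<close> it is an identity
between values and first derivatives at one point, and it can be differentiated.\<close>

definition homog :: "real \<Rightarrow> ((real ^ 'n) \<times> (real ^ 'n) \<Rightarrow> real) \<Rightarrow> bool" where
  "homog d f \<longleftrightarrow> (\<forall>z\<in>U. (\<Sum>m\<in>UNIV. snd z $ m * pdy m f z) = d * f z)"

lemma homogD: "homog d f \<Longrightarrow> z \<in> U \<Longrightarrow> (\<Sum>m\<in>UNIV. snd z $ m * pdy m f z) = d * f z"
  by (simp add: homog_def)

lemma homog_add:
  assumes "homog d f" "homog d g" "sm f" "sm g"
  shows "homog d (\<lambda>z. f z + g z)"
  using assms by (simp add: homog_def sum.distrib distrib_left)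

lemma homog_mult:
  assumes "homog d f" "homog e g" "sm f" "sm g" "c = d + e"
  shows "homog c (\<lambda>z. f z * g z)"
  unfolding homog_def
proof
  fix z assume z: "z \<in> U"
  have "(\<Sum>m\<in>UNIV. snd z $ m * pdy m (\<lambda>z. f z * g z) z)
      = g z * (\<Sum>m\<in>UNIV. snd z $ m * pdy m f z) + f z * (\<Sum>m\<in>UNIV. snd z $ m * pdy m g z)"
    using z assms by (simp add: sum_distrib_left sum.distrib[symmetric] algebra_simps)
  then show "(\<Sum>m\<in>UNIV. snd z $ m * pdy m (\<lambda>z. f z * g z) z) = c * (f z * g z)"
    using assms(5) homogD[OF assms(1) z] homogD[OF assms(2) z] by (simp add: algebra_simps)
qed

lemma homog_const: "homog 0 (\<lambda>z. c)"
  by (simp add: homog_def pdy_const)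

lemma homog_cmult: "homog d f \<Longrightarrow> sm f \<Longrightarrow> homog d (\<lambda>z. c * f z)"
  by (rule homog_mult[OF homog_const]) auto

lemma homog_diff:
  assumes "homog d f" "homog d g" "sm f" "sm g"
  shows "homog d (\<lambda>z. f z - g z)"
  using assms by (simp add: homog_def sum_subtractf right_diff_distrib)

lemma homog_sum:
  assumes "\<And>i. i \<in> I \<Longrightarrow> homog d (f i)" "\<And>i. i \<in> I \<Longrightarrow> sm (f i)"
  shows "homog d (\<lambda>z. \<Sum>i\<in>I. f i z)"
  using assms
proof (induction I rule: infinite_finite_induct)
  case (insert x F)
  have "homog d (\<lambda>z. f x z + (\<Sum>i\<in>F. f i z))"
    by (rule homog_add) (use insert in auto)
  then show ?case using insert.hyps by simp
qed (simp_all add: homog_def pdy_const)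

lemma homog_snd: "homog 1 (\<lambda>z. snd z $ i)"
  by (simp add: homog_def pdy_snd if_distrib cong: if_cong)

lemma homog_pdx:
  assumes "homog d f" "sm f"
  shows "homog d (pdx k f)"
  unfolding homog_def
proof
  fix z assume z: "z \<in> U"
  have "pdx k (\<lambda>z. \<Sum>m\<in>UNIV. snd z $ m * pdy m f z) z = pdx k (\<lambda>z. d * f z) z"
    using assms(1) z by (intro pd_cong) (auto simp: homog_def)
  then show "(\<Sum>m\<in>UNIV. snd z $ m * pdy m (pdx k f) z) = d * pdx k f z"
    using z assms(2) by (simp add: pdx_const pdx_snd pd_commute)
qed

lemma homog_pdy:
  assumes "homog d f" "sm f" "e = d - 1"
  shows "homog e (pdy k f)"
  unfolding homog_def
proof
  fix z assume z: "z \<in> U"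
  have "pdy k (\<lambda>z. \<Sum>m\<in>UNIV. snd z $ m * pdy m f z) z = pdy k (\<lambda>z. d * f z) z"
    using assms(1) z by (intro pd_cong) (auto simp: homog_def)
  then have "pdy k f z + (\<Sum>m\<in>UNIV. snd z $ m * pdy k (pdy m f) z) = d * pdy k f z"
    using z assms(2)
    by (simp add: pdy_const pdy_snd sum.distrib if_distrib[of "\<lambda>a. a * _"] cong: if_cong)
  then show "(\<Sum>m\<in>UNIV. snd z $ m * pdy m (pdy k f) z) = e * pdy k f z"
    using z assms(2,3) by (simp add: sum.distrib pd_commute(3)[of f z k] left_diff_distrib)
qed

end

text \<open>Differentiate \<open>f (x, r y) = r\<^sup>d f (x, y)\<close> with respect to \<open>r\<close> at \<open>r = 1\<close>.\<close>

lemma euler_relation: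
  fixes f :: "(real ^ 'n::finite) \<times> (real ^ 'n) \<Rightarrow> real"
  assumes f: "f differentiable (at (x, y))"
    and hom: "\<And>r. r > 0 \<Longrightarrow> f (x, r *\<^sub>R y) = r ^ d * f (x, y)"
  shows "(\<Sum>m\<in>UNIV. y $ m * pdy m f (x, y)) = real d * f (x, y)"
proof -
  let ?F = "\<lambda>v. dirderiv v f (x, y)"
  have F: "(f has_derivative ?F) (at (x, 1 *\<^sub>R y))" using has_derivative_dirderiv[OF f] by simp
  have lin: "linear ?F" by (rule has_derivative_linear[OF F])
  have "((\<lambda>r. f (x, r *\<^sub>R y)) has_derivative (\<lambda>r. ?F (0, r *\<^sub>R y))) (at 1)"
    by (rule has_derivative_compose[where f = "\<lambda>r. (x, r *\<^sub>R y)" and g = f, OF _ F])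
      (auto intro!: derivative_eq_intros)
  moreover have "?F (0, r *\<^sub>R y) = ?F (0, y) * r" for r
    using linear_cmul[OF lin, of r "(0, y)"] by (simp add: mult.commute)
  ultimately have "((\<lambda>r. f (x, r *\<^sub>R y)) has_real_derivative ?F (0, y)) (at 1)"
    by (simp add: has_field_derivative_def)
  moreover have "((\<lambda>r. f (x, r *\<^sub>R y)) has_real_derivative real d * f (x, y)) (at 1)"
  proof (rule DERIV_cong_ev[THEN iffD2, OF refl _ refl])
    show "eventually (\<lambda>r. f (x, r *\<^sub>R y) = r ^ d * f (x, y)) (nhds (1::real))"
      by (rule eventually_mono[OF eventually_nhds_in_open[of "{0<..}"]]) (auto intro: hom)
    show "((\<lambda>r. r ^ d * f (x, y)) has_real_derivative real d * f (x, y)) (at 1)"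
      by (auto intro!: derivative_eq_intros)
  qed
  ultimately have "?F (0, y) = real d * f (x, y)" by (rule DERIV_unique)
  moreover have "?F (0, y) = (\<Sum>m\<in>UNIV. y $ m * ?F (0, axis m 1))"
  proof -
    have "(0, y) = (\<Sum>m\<in>UNIV. y $ m *\<^sub>R (0::real ^ 'n, axis m 1))"
      using basis_expansion[of y] by (simp add: prod_eq_iff fst_sum snd_sum scalar_mult_eq_scaleR)
    then have "?F (0, y) = ?F (\<Sum>m\<in>UNIV. y $ m *\<^sub>R (0::real ^ 'n, axis m 1))" by (rule arg_cong)
    also have "\<dots> = (\<Sum>m\<in>UNIV. y $ m * ?F (0, axis m 1))"
      unfolding linear_sum[OF lin] by (simp only: linear_cmul[OF lin] real_scaleR_def)
    finally show ?thesis .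
  qed
  ultimately show ?thesis by (simp add: pdy_dirderiv)
qed

section \<open>Curvature of a spray on a surface\<close>

text \<open>The spray \<open>y\<^sup>m \<partial>/\<partial>x\<^sup>m - 2 G\<^sup>m \<partial>/\<partial>y\<^sup>m\<close> as a derivation.\<close>

definition spray_deriv :: "'n::finite coeffs \<Rightarrow> ((real ^ 'n) \<times> (real ^ 'n) \<Rightarrow> real) \<Rightarrow> (real ^ 'n) \<times> (real ^ 'n) \<Rightarrow> real" where
  "spray_deriv G f z = (\<Sum>m\<in>UNIV. snd z $ m * pdx m f z) - 2 * (\<Sum>m\<in>UNIV. G m z * pdy m f z)"

text \<open>The dynamical covariant derivative: the components \<open>A\<^sub>k\<^sub>\<bar>\<^sub>m y\<^sup>m\<close> in a form that involves neither the Berwald connection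
nor a sum over \<open>m\<close> of horizontal derivatives (see \<open>hderiv_covector_along_spray\<close>).\<close>

definition dyn_cov ::
    "'n::finite coeffs \<Rightarrow> ('n \<Rightarrow> (real ^ 'n) \<times> (real ^ 'n) \<Rightarrow> real) \<Rightarrow> 'n \<Rightarrow> (real ^ 'n) \<times> (real ^ 'n) \<Rightarrow> real" where
  "dyn_cov G A k z = spray_deriv G (A k) z - (\<Sum>l\<in>UNIV. nonlin_conn G l k z * A l z)"

locale surface_spray = region U for U :: "((real ^ 2) \<times> (real ^ 2)) set" +
  fixes G :: "2 coeffs"
  assumes smG [simp]: "sm (G i)" and homG: "homog 2 (G i)"
begin

lemma euler_G: "z \<in> U \<Longrightarrow> snd z $ 1 * pdy 1 (G i) z + snd z $ 2 * pdy 2 (G i) z = 2 * G i z"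
  using homogD[OF homG] by (simp add: sum_2)

lemma homog_N: "homog 1 (pdy j (G i))"
  by (rule homog_pdy[OF homG]) auto

lemma euler_N: "z \<in> U \<Longrightarrow> snd z $ 1 * pdy 1 (pdy j (G i)) z + snd z $ 2 * pdy 2 (pdy j (G i)) z = pdy j (G i) z"
  using homogD[OF homog_N] by (simp add: sum_2)

lemma sm_riemann [simp]: "sm (riemann_curv G i k)"
  unfolding riemann_curv_def[abs_def] by simp

lemma homog_riemann: "homog 2 (riemann_curv G i k)"
  unfolding riemann_curv_def[abs_def]
  by (intro homog_diff homog_add homog_cmult homog_sum homog_pdx[OF homG]
        homog_mult[OF homog_snd homog_pdx[OF homog_N]] homog_mult[OF homG homog_pdy[OF homog_N _ refl]]
        homog_mult[OF homog_N homog_N]) auto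

lemma ricci_scalar_eq: "ricci_scalar G = (\<lambda>z. riemann_curv G 1 1 z + riemann_curv G 2 2 z)"
  by (auto simp: ricci_scalar_def ricci_curv_def sum_2)

lemma sm_ricci [simp]: "sm (ricci_scalar G)"
  unfolding ricci_scalar_eq by simp

lemma homog_ricci: "homog 2 (ricci_scalar G)"
  unfolding ricci_scalar_eq by (intro homog_add homog_riemann) auto

lemma sm_T [simp]: "sm (T_curv G i k)"
  unfolding T_curv_def[abs_def] by simp

lemma homog_T: "homog 2 (T_curv G i k)"
  unfolding T_curv_def[abs_def]
  by (intro homog_diff homog_riemann homog_mult[OF homog_ricci homog_const]
       homog_mult[OF homog_cmult[OF homog_pdy[OF homog_ricci _ refl]] homog_snd]) auto

lemma sm_chi [simp]: "sm (chi_curv G k)"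
  unfolding chi_curv_def[abs_def] by simp

text \<open>By homogeneity \<open>N\<^sup>l\<^sub>m y\<^sup>m = 2 G\<^sup>l\<close> and \<open>\<Gamma>\<^sup>l\<^sub>k\<^sub>m y\<^sup>m = N\<^sup>l\<^sub>k\<close>.\<close>

lemma hderiv_covector_along_spray:
  assumes z: "z \<in> U"
  shows "(\<Sum>m\<in>UNIV. hderiv_covector G A k m z * snd z $ m) = dyn_cov G A k z"
proof -
  have e: "2 * G i z = snd z $ 1 * pdy 1 (G i) z + snd z $ 2 * pdy 2 (G i) z" for i
    using euler_G[OF z] by simp
  have "snd z $ 1 * pdy k (pdy 1 (G i)) z + snd z $ 2 * pdy k (pdy 2 (G i)) z = pdy k (G i) z" for i
    using euler_N[OF z, of k i] pd_commute(3)[OF smG z, of k] by simp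
  note N = this[symmetric]
  have "dyn_cov G A k z = snd z $ 1 * pdx 1 (A k) z + snd z $ 2 * pdx 2 (A k) z
      - (2 * G 1 z * pdy 1 (A k) z + 2 * G 2 z * pdy 2 (A k) z)
      - (pdy k (G 1) z * A 1 z + pdy k (G 2) z * A 2 z)"
    by (simp add: dyn_cov_def spray_deriv_def sum_2 nonlin_conn_def algebra_simps)
  then show ?thesis
    unfolding e N
    by (simp add: hderiv_covector_def hderiv_def sum_2 nonlin_conn_def berwald_conn_def algebra_simps)
qed

text \<open>Contracting the definition of \<open>R\<^sup>i\<^sub>k\<close> with \<open>y\<^sup>k\<close> turns each term, by Euler's relations for \<open>G\<^sup>i\<close> and its
derivatives, into one of \<open>y\<^sup>j \<partial>G\<^sup>i/\<partial>x\<^sup>j\<close> and \<open>G\<^sup>j N\<^sup>i\<^sub>j\<close>, and the coefficients add up to zero.\<close>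

lemma riemann_curv_kernel:
  assumes z: "z \<in> U"
  shows "riemann_curv G i 1 z * snd z $ 1 + riemann_curv G i 2 z * snd z $ 2 = 0"
proof -
  note e = euler_G[OF z] euler_N[OF z]
  have x: "snd z $ 1 * pdx j (pdy 1 (G i)) z + snd z $ 2 * pdx j (pdy 2 (G i)) z = 2 * pdx j (G i) z" for j
    using homogD[OF homog_pdx[OF homG smG] z, of j i] by (simp add: sum_2 pd_commute[OF smG z])
  have c: "pdy 2 (pdy 1 (G i)) z = pdy 1 (pdy 2 (G i)) z" by (rule pd_commute[OF smG z])
  show ?thesis
    unfolding riemann_curv_def sum_2
    using e(1)[of i] e(1)[of 1] e(1)[of 2] e(2)[of 1 i] e(2)[of 2 i] x[of 1] x[of 2] c
    by algebra
qed

text \<open>Cleared of denominators, so that the components can be used in polynomial arithmetic.\<close>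

lemma T_components:
  "2 * T_curv G 1 1 z = 2 * riemann_curv G 1 1 z - 2 * ricci_scalar G z + pdy 1 (ricci_scalar G) z * snd z $ 1"
  "2 * T_curv G 1 2 z = 2 * riemann_curv G 1 2 z + pdy 2 (ricci_scalar G) z * snd z $ 1"
  "2 * T_curv G 2 1 z = 2 * riemann_curv G 2 1 z + pdy 1 (ricci_scalar G) z * snd z $ 2"
  "2 * T_curv G 2 2 z = 2 * riemann_curv G 2 2 z - 2 * ricci_scalar G z + pdy 2 (ricci_scalar G) z * snd z $ 2"
  by (simp_all add: T_curv_def)

lemma euler_ricci:
  "z \<in> U \<Longrightarrow> snd z $ 1 * pdy 1 (ricci_scalar G) z + snd z $ 2 * pdy 2 (ricci_scalar G) z = 2 * ricci_scalar G z"
  using homogD[OF homog_ricci] by (simp add: sum_2)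

text \<open>\<open>R \<delta>\<^sup>i\<^sub>k - 1/2 R\<^sub>.\<^sub>k y\<^sup>i\<close> is built so that it annihilates \<open>y\<^sup>k\<close> as well.\<close>

lemma T_curv_kernel:
  assumes z: "z \<in> U"
  shows "T_curv G i 1 z * snd z $ 1 + T_curv G i 2 z * snd z $ 2 = 0"
proof -
  have "T_curv G 1 1 z * snd z $ 1 + T_curv G 1 2 z * snd z $ 2 = 0"
    using riemann_curv_kernel[OF z, of 1] euler_ricci[OF z] T_components(1,2)[of z] by algebra
  moreover have "T_curv G 2 1 z * snd z $ 1 + T_curv G 2 2 z * snd z $ 2 = 0"
    using riemann_curv_kernel[OF z, of 2] euler_ricci[OF z] T_components(3,4)[of z] by algebra
  ultimately show ?thesis using exhaust_2[of i] by auto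
qed

lemma T_curv_trace:
  assumes z: "z \<in> U"
  shows "T_curv G 1 1 z + T_curv G 2 2 z = 0"
  using euler_ricci[OF z] T_components(1,4)[of z] fun_cong[OF ricci_scalar_eq, of z]
  by (simp add: algebra_simps)

text \<open>A trace-free endomorphism of the plane that kills \<open>y\<close> maps into the line of \<open>y\<close>: \<open>T\<^sup>l\<^sub>k = y\<^sup>l \<theta>\<^sub>k\<close> for a
covector \<open>\<theta>\<close>. The statement expresses this without naming \<open>\<theta>\<close>, which would have to be obtained by dividing by a
component of \<open>y\<close>.\<close>

lemma T_curv_rank_one:
  assumes z: "z \<in> U"
  shows "snd z $ j * T_curv G l k z = snd z $ l * T_curv G j k z"
proof -
  have "snd z $ 1 * T_curv G 2 k z = snd z $ 2 * T_curv G 1 k z"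
  proof -
    have "snd z $ 1 * T_curv G 2 1 z = snd z $ 2 * T_curv G 1 1 z"
      "snd z $ 1 * T_curv G 2 2 z = snd z $ 2 * T_curv G 1 2 z"
      using T_curv_kernel[OF z, of 1] T_curv_kernel[OF z, of 2] T_curv_trace[OF z] by algebra+
    then show ?thesis using exhaust_2[of k] by auto
  qed
  then show ?thesis using exhaust_2[of j] exhaust_2[of l] by (elim disjE) simp_all
qed

text \<open>Taking the \<open>y\<close>-divergence of \<open>y\<^sup>j T\<^sup>l\<^sub>k = y\<^sup>l T\<^sup>j\<^sub>k\<close> over \<open>j\<close> gives \<open>(2 + 2) T\<^sup>l\<^sub>k = T\<^sup>l\<^sub>k + y\<^sup>l T\<^sup>j\<^sub>k\<^sub>.\<^sub>j\<close>, where one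
summand \<open>2\<close> is the dimension and the other the degree of homogeneity of \<open>T\<close>. The divergence is
\<open>- 3 \<chi>\<^sub>k\<close>.\<close>

lemma T_curv_eq_chi_curv:
  assumes z: "z \<in> U"
  shows "T_curv G l k z = - chi_curv G k z * snd z $ l"
proof -
  have "pdy j (\<lambda>z. snd z $ j * T_curv G l k z) z = pdy j (\<lambda>z. snd z $ l * T_curv G j k z) z" for j
    by (rule pd_cong[OF T_curv_rank_one z])
  then have d: "T_curv G l k z + snd z $ j * pdy j (T_curv G l k) z
       = (if j = l then T_curv G j k z else 0) + snd z $ l * pdy j (T_curv G j k) z" for j
    using z by (simp add: pdy_snd)
  have h: "snd z $ 1 * pdy 1 (T_curv G l k) z + snd z $ 2 * pdy 2 (T_curv G l k) z = 2 * T_curv G l k z"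
    using homogD[OF homog_T z] by (simp add: sum_2)
  have "3 * T_curv G l k z = snd z $ l * (pdy 1 (T_curv G 1 k) z + pdy 2 (T_curv G 2 k) z)"
    using d[of 1] d[of 2] h exhaust_2[of l] by (auto simp: distrib_left)
  then show ?thesis by (simp add: chi_curv_def sum_2 algebra_simps)
qed

text \<open>On a surface the Ricci scalar and the \<open>\<chi>\<close>-curvature determine the whole Riemann curvature.\<close>

theorem riemann_curv_surface:
  assumes z: "z \<in> U"
  shows "riemann_curv G l k z = ricci_scalar G z * (if l = k then 1 else 0)
    - 1/2 * pdy k (ricci_scalar G) z * snd z $ l - chi_curv G k z * snd z $ l"
  using T_curv_eq_chi_curv[OF z, of l k] by (simp add: T_curv_def)

lemma sm_spray_deriv [simp]: "sm f \<Longrightarrow> sm (spray_deriv G f)"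
  unfolding spray_deriv_def[abs_def] by simp

lemma sm_hderiv [simp]: "sm f \<Longrightarrow> sm (hderiv G f k)"
  unfolding hderiv_def[abs_def] nonlin_conn_def[abs_def] by simp

lemma deriv_cong:
  assumes "\<And>z. z \<in> U \<Longrightarrow> f z = g z" "z \<in> U"
  shows "hderiv G f k z = hderiv G g k z" "spray_deriv G f z = spray_deriv G g z"
  using pd_cong[OF assms] by (simp_all add: hderiv_def spray_deriv_def)

lemma dyn_cov_cong:
  assumes "\<And>z j. z \<in> U \<Longrightarrow> A j z = B j z" "z \<in> U"
  shows "dyn_cov G A k z = dyn_cov G B k z"
  using deriv_cong(2)[of "A k" "B k", OF assms(1) assms(2)] assms by (simp add: dyn_cov_def)

lemma dyn_cov_diff:
  assumes "z \<in> U" and "\<And>j. sm (A j)" "\<And>j. sm (B j)"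
  shows "dyn_cov G (\<lambda>j z. A j z - B j z) k z = dyn_cov G A k z - dyn_cov G B k z"
  using assms by (simp add: dyn_cov_def spray_deriv_def sum_2 algebra_simps)

lemma dyn_cov_cmult:
  assumes "z \<in> U" and "\<And>j. sm (A j)"
  shows "dyn_cov G (\<lambda>j z. c * A j z) k z = c * dyn_cov G A k z"
  using assms by (simp add: dyn_cov_def spray_deriv_def sum_2 pdx_const pdy_const algebra_simps)

lemma hderiv_diff:
  assumes "z \<in> U" and "sm f" "sm g"
  shows "hderiv G (\<lambda>z. f z - g z) k z = hderiv G f k z - hderiv G g k z"
  using assms by (simp add: hderiv_def sum_2 algebra_simps)

lemma hderiv_cmult:
  assumes "z \<in> U" and "sm f"
  shows "hderiv G (\<lambda>z. c * f z) k z = c * hderiv G f k z"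
  using assms by (simp add: hderiv_def sum_2 pdx_const pdy_const algebra_simps)

text \<open>The bracket of \<open>\<partial>/\<partial>y\<^sup>k\<close> with the spray is \<open>\<partial>/\<partial>x\<^sup>k - 2 N\<^sup>l\<^sub>k \<partial>/\<partial>y\<^sup>l\<close>; one \<open>N\<close> belongs to the horizontal
derivative, the other to the covariant derivative of \<open>P\<^sub>.\<^sub>k\<close>.\<close>

lemma pdy_spray_deriv:
  assumes z: "z \<in> U" and P: "sm P"
  shows "pdy k (spray_deriv G P) z = hderiv G P k z + dyn_cov G (\<lambda>j. pdy j P) k z"
proof -
  have "spray_deriv G P = (\<lambda>z. (snd z $ 1 * pdx 1 P z + snd z $ 2 * pdx 2 P z) - 2 * (G 1 z * pdy 1 P z + G 2 z * pdy 2 P z))"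
    by (auto simp: spray_deriv_def sum_2)
  then show ?thesis
    using z P exhaust_2[of k]
    by (auto simp: pdy_snd pdy_const dyn_cov_def hderiv_def spray_deriv_def sum_2 nonlin_conn_def
         pd_commute(2)[OF P z] pd_commute(3)[OF P z, of 2 1] algebra_simps)
qed

text \<open>The Riemann curvature is the vertical part of the bracket of the spray with a horizontal derivative: the second
derivatives of \<open>P\<close> cancel and the coefficient of \<open>P\<^sub>.\<^sub>l\<close> is the definition of \<open>R\<^sup>l\<^sub>k\<close>.\<close>

lemma horizontal_commutator:
  assumes z: "z \<in> U" and P: "sm P"
  shows "dyn_cov G (\<lambda>j. hderiv G P j) k z - hderiv G (spray_deriv G P) k z
    = (\<Sum>l\<in>UNIV. riemann_curv G l k z * pdy l P z)"
proof -
  have h: "hderiv G P j = (\<lambda>z. pdx j P z - (pdy j (G 1) z * pdy 1 P z + pdy j (G 2) z * pdy 2 P z))" for j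
    by (auto simp: hderiv_def sum_2 nonlin_conn_def)
  have s: "spray_deriv G P = (\<lambda>z. (snd z $ 1 * pdx 1 P z + snd z $ 2 * pdx 2 P z) - 2 * (G 1 z * pdy 1 P z + G 2 z * pdy 2 P z))"
    by (auto simp: spray_deriv_def sum_2)
  have c: "pdx 2 (pdx 1 P) z = pdx 1 (pdx 2 P) z" "pdy 2 (pdy 1 P) z = pdy 1 (pdy 2 P) z"
      "pdy i (pdx j P) z = pdx j (pdy i P) z" for i j
    by (simp_all add: pd_commute[OF P z, of 2 1] pd_commute(2)[OF P z])
  have cG: "pdy 2 (pdy 1 (G l)) z = pdy 1 (pdy 2 (G l)) z"
     "pdy i (pdx j (G l)) z = pdx j (pdy i (G l)) z" for i j l
    by (simp_all add: pd_commute[OF smG z, of 2 1] pd_commute(2)[OF smG z])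
  show ?thesis
    unfolding dyn_cov_def h s unfolding spray_deriv_def hderiv_def nonlin_conn_def sum_2 riemann_curv_def
    by (rule disjE[OF exhaust_2[of k]])
      (simp_all add: z P pdy_snd pdx_snd pdy_const pdx_const c cG algebra_simps)
qed

section \<open>The \<open>\<chi>\<close>-curvature as the Euler-Lagrange expression of the S-curvature\<close>

text \<open>For the divergence \<open>D = N\<^sup>m\<^sub>m\<close>. On a surface \<open>T\<^sup>m\<^sub>k\<^sub>.\<^sub>m = R\<^sup>m\<^sub>k\<^sub>.\<^sub>m + 1/2 R\<^sup>m\<^sub>m\<^sub>.\<^sub>k\<close>, and in
\<open>2 R\<^sup>m\<^sub>k\<^sub>.\<^sub>m + R\<^sup>m\<^sub>m\<^sub>.\<^sub>k\<close> all terms cancel that are not derivatives of the trace \<open>D\<close>. What is left is a multiple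
of \<open>D\<^sub>.\<^sub>k\<^sub>\<bar>\<^sub>0 - D\<^sub>\<bar>\<^sub>k\<close>.\<close>

lemma chi_curv_divergence:
  assumes z: "z \<in> U"
  defines "D \<equiv> \<lambda>z. pdy 1 (G 1) z + pdy 2 (G 2) z"
  shows "chi_curv G k z = 1/2 * (dyn_cov G (\<lambda>j. pdy j D) k z - hderiv G D k z)"
proof -
  have smD: "sm D" by (simp add: D_def)
  note comm = pd_commute[OF _ z] pd_commute_under[OF _ z]
  have T: "T_curv G m k = (\<lambda>z. riemann_curv G m k z
     - (ricci_scalar G z * (if m = k then 1 else 0) - 1/2 * (pdy k (ricci_scalar G) z * snd z $ m)))" for m
    by (rule ext) (simp add: T_curv_def)
  have hR: "snd z $ 1 * pdy 1 (pdy k (ricci_scalar G)) z + snd z $ 2 * pdy 2 (pdy k (ricci_scalar G)) z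
      = pdy k (ricci_scalar G) z"
    using homogD[OF homog_pdy[OF homog_ricci _ refl] z] by (simp add: sum_2)
  have "pdy 1 (T_curv G 1 k) z + pdy 2 (T_curv G 2 k) z
     = pdy 1 (riemann_curv G 1 k) z + pdy 2 (riemann_curv G 2 k) z + 1/2 * pdy k (ricci_scalar G) z"
    unfolding T using z exhaust_2[of k] hR by (auto simp: pdy_const pdy_snd field_simps)
  then have chi: "chi_curv G k z = - (1/6) * (2 * (pdy 1 (riemann_curv G 1 k) z + pdy 2 (riemann_curv G 2 k) z)
       + pdy k (ricci_scalar G) z)"
    by (simp add: chi_curv_def sum_2)
  have pD: "pdy j D w = pdy j (pdy 1 (G 1)) w + pdy j (pdy 2 (G 2)) w"
      "pdx j D w = pdx j (pdy 1 (G 1)) w + pdx j (pdy 2 (G 2)) w" if "w \<in> U" for j w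
    using that by (simp_all add: D_def)
  have pyD: "pdx i (pdy j D) z = pdx i (pdy j (pdy 1 (G 1))) z + pdx i (pdy j (pdy 2 (G 2))) z"
      "pdy i (pdy j D) z = pdy i (pdy j (pdy 1 (G 1))) z + pdy i (pdy j (pdy 2 (G 2))) z" for i j
    using pd_cong[of "pdy j D" "\<lambda>w. pdy j (pdy 1 (G 1)) w + pdy j (pdy 2 (G 2)) w", OF pD(1) z] z
    by simp_all
  show ?thesis
    unfolding chi ricci_scalar_eq dyn_cov_def spray_deriv_def hderiv_def nonlin_conn_def sum_2
    unfolding riemann_curv_def[abs_def] sum_2
    by (rule disjE[OF exhaust_2[of k]])
      (simp_all add: z smD pdy_snd pdx_snd pdy_const pdx_const comm pD pyD algebra_simps)
qed

text \<open>\<open>L\<^sub>\<bar>\<^sub>k - L\<^sub>.\<^sub>k\<^sub>\<bar>\<^sub>0\<close> is the Euler-Lagrange expression of \<open>L\<close> along the spray. It vanishes for the total derivative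
\<open>L = y\<^sup>m \<partial>h/\<partial>x\<^sup>m\<close> of a function \<open>h\<close> on the base, because second partial derivatives of \<open>h\<close> commute.\<close>

lemma euler_lagrange_total_derivative:
  assumes z: "z \<in> U" and h: "sm h" "\<And>j w. w \<in> U \<Longrightarrow> pdy j h w = 0"
  defines "L \<equiv> \<lambda>z. snd z $ 1 * pdx 1 h z + snd z $ 2 * pdx 2 h z"
  shows "dyn_cov G (\<lambda>j. pdy j L) k z = hderiv G L k z"
proof -
  have L: "pdy j L w = pdx j h w" if w: "w \<in> U" for j w
  proof -
    have "pdy j (pdx i h) w = 0" for i
      using pd_cong(1)[of "pdy j h" "\<lambda>_. 0", OF h(2) w] by (simp add: pd_commute h(1) w pdx_const)
    then show ?thesis using w h(1) exhaust_2[of j] by (auto simp: L_def pdy_snd)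
  qed
  have y0: "pdy j (pdx i h) z = 0" for i j
    using pd_cong(1)[of "pdy j h" "\<lambda>_. 0", OF h(2) z] by (simp add: pd_commute h(1) z pdx_const)
  have "dyn_cov G (\<lambda>j. pdy j L) k z = dyn_cov G (\<lambda>j. pdx j h) k z"
    by (rule dyn_cov_cong) (use L z in auto)
  also have "\<dots> = hderiv G L k z"
    using h(1) z
    by (simp add: dyn_cov_def hderiv_def spray_deriv_def sum_2 nonlin_conn_def y0 L)
       (simp add: L_def pdx_snd pd_commute[OF h(1) z, of k])
  finally show ?thesis .
qed

text \<open>With \<open>h = ln \<sigma>\<close> the volume form contributes a total derivative to the S-curvature, and this is why it drops out of
the Euler-Lagrange expression.\<close>

lemma S_curv_eq_divergence_minus_total_derivative:
  assumes X: "U = slit X" and \<sigma>: "smooth_map_on X \<sigma>" "\<forall>x\<in>X. \<sigma> x > 0" and oX: "open X"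
  defines "h \<equiv> \<lambda>z. ln (\<sigma> (fst z))"
  shows "sm h" and "z \<in> U \<Longrightarrow> pdy j h z = 0"
    and "z \<in> U \<Longrightarrow> S_curv G \<sigma> z = (pdy 1 (G 1) z + pdy 2 (G 2) z) - (snd z $ 1 * pdx 1 h z + snd z $ 2 * pdx 2 h z)"
proof -
  have l: "smooth_map_on X (\<lambda>x. ln (\<sigma> x))"
    using \<sigma>(2) Ck_on_ln[OF oX, of _ \<sigma>] \<sigma>(1) unfolding smooth_map_on_def by blast
  have fst_U: "fst ` U \<subseteq> X" by (auto simp: X slit_def)
  from l show "sm h"
    using Ck_on_fst[OF open_U fst_U] unfolding smooth_map_on_def h_def by blast
  have d: "dirderiv v h z = dirderiv (fst v) (\<lambda>x. ln (\<sigma> x)) (fst z)" if "z \<in> U" for v z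
    unfolding h_def by (rule dirderiv_fst[OF smooth_map_on_differentiable[OF l]]) (use that fst_U in blast)
  show "pdy j h z = 0" if "z \<in> U"
  proof -
    have "(\<lambda>x. ln (\<sigma> x)) differentiable (at (fst z))"
      by (rule smooth_map_on_differentiable[OF l]) (use that fst_U in blast)
    then have "linear (\<lambda>v. dirderiv v (\<lambda>x. ln (\<sigma> x)) (fst z))"
      by (intro has_derivative_linear[OF has_derivative_dirderiv])
    then have "dirderiv 0 (\<lambda>x. ln (\<sigma> x)) (fst z) = 0" by (rule linear_0)
    then show ?thesis by (simp add: pdy_dirderiv d that)
  qed
  show "S_curv G \<sigma> z = (pdy 1 (G 1) z + pdy 2 (G 2) z) - (snd z $ 1 * pdx 1 h z + snd z $ 2 * pdx 2 h z)"
    if "z \<in> U"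
    using that by (simp add: S_curv_def sum_2 pdx_dirderiv d) (simp add: dirderiv_def)
qed

lemma S_curv_properties:
  assumes X: "U = slit X" "smooth_map_on X \<sigma>" "\<forall>x\<in>X. \<sigma> x > 0" "open X"
  shows smooth_S_curv: "sm (S_curv G \<sigma>)" and homog_S_curv: "homog 1 (S_curv G \<sigma>)"
    and chi_curv_S_curv: "z \<in> U \<Longrightarrow> chi_curv G k z
      = 1/2 * (dyn_cov G (\<lambda>j. pdy j (S_curv G \<sigma>)) k z - hderiv G (S_curv G \<sigma>) k z)"
proof -
  define h where "h = (\<lambda>z::(real^2)\<times>(real^2). ln (\<sigma> (fst z)))"
  define D where "D = (\<lambda>z. pdy 1 (G 1) z + pdy 2 (G 2) z)"
  define L where "L = (\<lambda>z. snd z $ 1 * pdx 1 h z + snd z $ 2 * pdx 2 h z)"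
  note split = S_curv_eq_divergence_minus_total_derivative[OF X, folded h_def]
  have S: "S_curv G \<sigma> z = D z - L z" if "z \<in> U" for z
    using split(3)[OF that] by (simp add: D_def L_def)
  have smD [simp]: "sm D" and smL [simp]: "sm L" using split(1) by (simp_all add: D_def L_def)
  show "sm (S_curv G \<sigma>)" by (rule sm_cong[of "\<lambda>z. D z - L z"]) (simp_all add: S)
  have h0: "homog 0 h" by (simp add: homog_def split(2))
  have "homog 1 (\<lambda>z. D z - L z)"
    unfolding D_def L_def
    by (intro homog_diff homog_add homog_N homog_mult[OF homog_snd homog_pdx[OF h0 split(1)]]) (simp_all add: split(1))
  then show "homog 1 (S_curv G \<sigma>)"
    by (simp add: homog_def S pd_cong(2)[OF S])
  show "chi_curv G k z = 1/2 * (dyn_cov G (\<lambda>j. pdy j (S_curv G \<sigma>)) k z - hderiv G (S_curv G \<sigma>) k z)"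
    if z: "z \<in> U"
  proof -
    have "hderiv G (S_curv G \<sigma>) k z = hderiv G (\<lambda>z. D z - L z) k z"
      by (rule deriv_cong[OF S z])
    also have "\<dots> = hderiv G D k z - hderiv G L k z"
      by (rule hderiv_diff[OF z smD smL])
    finally have 1: "hderiv G (S_curv G \<sigma>) k z = hderiv G D k z - hderiv G L k z" .
    have pS: "pdy j (S_curv G \<sigma>) w = pdy j D w - pdy j L w" if "w \<in> U" for j w
      using pd_cong(2)[OF S that, where k = j] that by simp
    have "dyn_cov G (\<lambda>j. pdy j (S_curv G \<sigma>)) k z = dyn_cov G (\<lambda>j w. pdy j D w - pdy j L w) k z"
      by (rule dyn_cov_cong[OF pS z])
    also have "\<dots> = dyn_cov G (\<lambda>j. pdy j D) k z - dyn_cov G (\<lambda>j. pdy j L) k z"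
      by (rule dyn_cov_diff[OF z]) simp_all
    also have "dyn_cov G (\<lambda>j. pdy j L) k z = hderiv G L k z"
      unfolding L_def by (rule euler_lagrange_total_derivative[OF z split(1,2)])
    finally show ?thesis using chi_curv_divergence[OF z, of k] 1 by (simp add: D_def)
  qed
qed

end

section \<open>Projective change of a spray on a surface\<close>

locale projective_change = surface_spray +
  fixes P :: "(real ^ 2) \<times> (real ^ 2) \<Rightarrow> real"
  assumes smP [simp]: "sm P" and homP: "homog 1 P"
begin

definition H :: "2 coeffs" where
  "H i z = G i z + P z * snd z $ i"

lemma H_abs: "H i = (\<lambda>z. G i z + P z * snd z $ i)"
  by (auto simp: H_def)

sublocale H: surface_spray U H
proof
  show "sm (H i)" for i by (simp add: H_abs)
  show "homog 2 (H i)" for i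
    unfolding H_abs by (intro homog_add homG homog_mult[OF homP homog_snd]) auto
qed

lemma euler_P: "z \<in> U \<Longrightarrow> snd z $ 1 * pdy 1 P z + snd z $ 2 * pdy 2 P z = P z"
  using homogD[OF homP] by (simp add: sum_2)

lemma pdy_H: "z \<in> U \<Longrightarrow> pdy j (H i) z = pdy j (G i) z + pdy j P z * snd z $ i + P z * (if j = i then 1 else 0)"
  by (simp add: H_abs pdy_snd)

lemma pdx_H: "z \<in> U \<Longrightarrow> pdx j (H i) z = pdx j (G i) z + pdx j P z * snd z $ i"
  by (simp add: H_abs pdx_snd)

lemma pd_pdy_H:
  assumes "z \<in> U"
  shows "pdx l (pdy j (H i)) z = pdx l (pdy j (G i)) z + pdx l (pdy j P) z * snd z $ i + pdx l P z * (if j = i then 1 else 0)"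
    and "pdy l (pdy j (H i)) z = pdy l (pdy j (G i)) z + pdy l (pdy j P) z * snd z $ i
           + pdy j P z * (if l = i then 1 else 0) + pdy l P z * (if j = i then 1 else 0)"
  using pd_cong[of "pdy j (H i)", OF pdy_H assms] assms
  by (simp_all add: pdx_snd pdy_snd pdx_const pdy_const)

text \<open>The trace contracts every second derivative of \<open>P\<close> with \<open>y\<close>, so Euler's relations leave first derivatives only.\<close>

lemma ricci_scalar_projective_change:
  assumes z: "z \<in> U"
  shows "ricci_scalar H z = ricci_scalar G z + P z * P z - spray_deriv G P z"
proof -
  \<comment> \<open>The defects of the Euler relations for \<open>P\<close>, its derivatives, \<open>G\<^sup>i\<close> and \<open>N\<^sup>i\<^sub>i\<close>.\<close>
  define e where "e = snd z $ 1 * pdy 1 P z + snd z $ 2 * pdy 2 P z - P z"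
  define ey where "ey j = snd z $ 1 * pdy 1 (pdy j P) z + snd z $ 2 * pdy 2 (pdy j P) z" for j
  define ex where "ex j = snd z $ 1 * pdx j (pdy 1 P) z + snd z $ 2 * pdx j (pdy 2 P) z - pdx j P z" for j
  define eG where "eG i = snd z $ 1 * pdy 1 (G i) z + snd z $ 2 * pdy 2 (G i) z - 2 * G i z" for i
  define eN where "eN i = snd z $ 1 * pdy 1 (pdy i (G i)) z + snd z $ 2 * pdy 2 (pdy i (G i)) z - pdy i (G i) z" for i
  have euler: "e = 0" "ey j = 0" "ex j = 0" "eG i = 0" "eN i = 0" for i j
    using euler_P[OF z] homogD[OF homog_pdy[OF homP _ refl] z, of j]
      homogD[OF homog_pdx[OF homP smP] z, of j] euler_G[OF z] euler_N[OF z]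
    by (simp_all add: e_def ey_def ex_def eG_def eN_def sum_2 pd_commute(2)[OF smP z])
  have c: "pdy 2 (pdy 1 P) z = pdy 1 (pdy 2 P) z" "pdy 2 (pdy 1 (G i)) z = pdy 1 (pdy 2 (G i)) z" for i
    by (simp_all add: pd_commute[OF smP z, of 2 1] pd_commute[OF smG z, of 2 1])
  \<comment> \<open>As an identity of polynomials in the derivatives, the claim holds modulo the defects. Their coefficients are read off
    from the expanded trace: each is what multiplies the corresponding contraction with \<open>y\<close>.\<close>
  have "ricci_scalar H z - (ricci_scalar G z + P z * P z - spray_deriv G P z)
     = 2 * P z * (eN 1 + eN 2) + 2 * (H 1 z * ey 1 + H 2 z * ey 2) - (snd z $ 1 * ex 1 + snd z $ 2 * ex 2)
       + (3 * P z - (snd z $ 1 * pdy 1 P z + snd z $ 2 * pdy 2 P z)) * e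
       - 2 * (pdy 1 P z * eG 1 + pdy 2 P z * eG 2)"
    unfolding ricci_scalar_eq H.ricci_scalar_eq riemann_curv_def spray_deriv_def sum_2
      e_def ey_def ex_def eG_def eN_def
    by (simp add: pdy_H pdx_H pd_pdy_H z c) (simp add: H_def algebra_simps)
  then show ?thesis by (simp add: euler)
qed

text \<open>The connection coefficients change by \<open>P \<delta>\<^sup>l\<^sub>k + P\<^sub>.\<^sub>k y\<^sup>l\<close>; the second term meets \<open>f\<^sub>.\<^sub>l y\<^sup>l\<close>, which is \<open>2 f\<close> for degree two.\<close>

lemma hderiv_projective_change:
  assumes z: "z \<in> U" and f: "homog 2 f"
  shows "hderiv H f k z = hderiv G f k z - P z * pdy k f z - 2 * pdy k P z * f z"
proof -
  have e: "snd z $ 1 * pdy 1 f z + snd z $ 2 * pdy 2 f z = 2 * f z"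
    using homogD[OF f z] by (simp add: sum_2)
  have "hderiv H f k z = hderiv G f k z - P z * pdy k f z
      - pdy k P z * (snd z $ 1 * pdy 1 f z + snd z $ 2 * pdy 2 f z)"
    using exhaust_2[of k] by (auto simp: hderiv_def nonlin_conn_def sum_2 pdy_H z algebra_simps)
  then show ?thesis unfolding e by simp
qed

text \<open>The spray itself changes by \<open>- 2 P y\<^sup>m \<partial>/\<partial>y\<^sup>m\<close>, which multiplies \<open>A\<^sub>k\<close> of degree one by \<open>- 2 P\<close>; the term \<open>P \<delta>\<^sup>l\<^sub>k\<close> of
the connection contributes another \<open>- P A\<^sub>k\<close>.\<close>

lemma dyn_cov_projective_change:
  assumes z: "z \<in> U" and A: "homog 1 (A k)"
  shows "dyn_cov H A k z = dyn_cov G A k z - 3 * P z * A k z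
      - pdy k P z * (snd z $ 1 * A 1 z + snd z $ 2 * A 2 z)"
proof -
  have e: "snd z $ 1 * pdy 1 (A k) z + snd z $ 2 * pdy 2 (A k) z = A k z"
    using homogD[OF A z] by (simp add: sum_2)
  have "dyn_cov H A k z = dyn_cov G A k z - 2 * P z * (snd z $ 1 * pdy 1 (A k) z + snd z $ 2 * pdy 2 (A k) z)
      - P z * A k z - pdy k P z * (snd z $ 1 * A 1 z + snd z $ 2 * A 2 z)"
    using exhaust_2[of k]
    by (auto simp: dyn_cov_def spray_deriv_def nonlin_conn_def sum_2 pdy_H z H_def algebra_simps)
  then show ?thesis unfolding e by simp
qed

text \<open>The hypothesis says that \<open>P\<^sub>\<bar>\<^sub>k - P\<^sub>.\<^sub>k\<^sub>\<bar>\<^sub>0 = 2/3 \<chi>\<^sub>k\<close>, which holds for \<open>P = - S/3\<close>. Then \<open>P\<^sub>\<bar>\<^sub>0\<^sub>.\<^sub>k\<close> is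
\<open>2 P\<^sub>\<bar>\<^sub>k - 2/3 \<chi>\<^sub>k\<close>, so second horizontal derivatives of \<open>P\<close> occur only through the commutator. The terms with \<open>P\<close>
that survive it, \<open>3/2 P (P\<^sub>\<bar>\<^sub>k - P\<^sub>.\<^sub>k\<^sub>\<bar>\<^sub>0) - \<chi>\<^sub>k P\<close>, vanish by the hypothesis.\<close>

lemma weyl_projective_change:
  assumes z: "z \<in> U"
    and chi: "\<And>k z. z \<in> U \<Longrightarrow> dyn_cov G (\<lambda>j. pdy j P) k z = hderiv G P k z - 2/3 * chi_curv G k z"
  shows "hderiv H (ricci_scalar H) k z - 1/2 * dyn_cov H (\<lambda>j. pdy j (ricci_scalar H)) k z
    = hderiv G (ricci_scalar G) k z - 1/2 * dyn_cov G (\<lambda>j. pdy j (ricci_scalar G)) k z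
      - 1/3 * dyn_cov G (chi_curv G) k z"
proof -
  let ?R = "ricci_scalar G" and ?Rh = "ricci_scalar H"
  let ?V = "\<lambda>k. dyn_cov G (\<lambda>j. pdy j P) k"
  have sP: "pdy j (spray_deriv G P) w = 2 * hderiv G P j w - 2/3 * chi_curv G j w" if "w \<in> U" for j w
    using pdy_spray_deriv[OF that smP] chi[OF that] by simp
  have Rh_y: "pdy j ?Rh w = pdy j ?R w + 2 * (P w * pdy j P w) - (2 * hderiv G P j w - 2/3 * chi_curv G j w)"
    if "w \<in> U" for j w
    using pd_cong(2)[OF ricci_scalar_projective_change that, where k = j] that sP[OF that] by simp
  have 1: "hderiv H ?Rh k z = hderiv G ?Rh k z - P z * pdy k ?Rh z - 2 * pdy k P z * ?Rh z"
    by (rule hderiv_projective_change[OF z H.homog_ricci])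
  have 2: "dyn_cov H (\<lambda>j. pdy j ?Rh) k z = dyn_cov G (\<lambda>j. pdy j ?Rh) k z - 3 * P z * pdy k ?Rh z
      - pdy k P z * (2 * ?Rh z)"
    using dyn_cov_projective_change[OF z homog_pdy[OF H.homog_ricci], of "\<lambda>j. j"] H.euler_ricci[OF z] by simp
  have "hderiv G ?Rh k z = hderiv G (\<lambda>z. ?R z + P z * P z - spray_deriv G P z) k z"
    by (rule deriv_cong[OF ricci_scalar_projective_change z])
  also have "\<dots> = hderiv G ?R k z + 2 * (P z * hderiv G P k z) - hderiv G (spray_deriv G P) k z"
    using z by (simp add: hderiv_def sum_2 algebra_simps)
  finally have 3: "hderiv G ?Rh k z = hderiv G ?R k z + 2 * (P z * hderiv G P k z) - hderiv G (spray_deriv G P) k z" .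
  have "dyn_cov G (\<lambda>j. pdy j ?Rh) k z = dyn_cov G (\<lambda>j w. pdy j ?R w + 2 * (P w * pdy j P w)
       - (2 * hderiv G P j w - 2/3 * chi_curv G j w)) k z"
    by (rule dyn_cov_cong[OF Rh_y z])
  also have "\<dots> = dyn_cov G (\<lambda>j. pdy j ?R) k z + 2 * (spray_deriv G P z * pdy k P z + P z * ?V k z)
      - (2 * dyn_cov G (\<lambda>j. hderiv G P j) k z - 2/3 * dyn_cov G (chi_curv G) k z)"
    using z by (simp add: dyn_cov_def spray_deriv_def sum_2 nonlin_conn_def pdx_const pdy_const field_simps)
  finally have 4: "dyn_cov G (\<lambda>j. pdy j ?Rh) k z = dyn_cov G (\<lambda>j. pdy j ?R) k z
      + 2 * (spray_deriv G P z * pdy k P z + P z * ?V k z)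
      - (2 * dyn_cov G (\<lambda>j. hderiv G P j) k z - 2/3 * dyn_cov G (chi_curv G) k z)" .
  \<comment> \<open>The decomposition of the Riemann curvature on a surface, contracted with \<open>P\<^sub>.\<^sub>l\<close>.\<close>
  have 5: "dyn_cov G (\<lambda>j. hderiv G P j) k z - hderiv G (spray_deriv G P) k z
     = ?R z * pdy k P z - 1/2 * pdy k ?R z * P z - chi_curv G k z * P z"
  proof -
    have "dyn_cov G (\<lambda>j. hderiv G P j) k z - hderiv G (spray_deriv G P) k z
       = ?R z * pdy k P z - (1/2 * pdy k ?R z + chi_curv G k z) * (snd z $ 1 * pdy 1 P z + snd z $ 2 * pdy 2 P z)"
      unfolding horizontal_commutator[OF z smP] riemann_curv_surface[OF z] sum_2
      using exhaust_2[of k] by (auto simp: algebra_simps)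
    then show ?thesis unfolding euler_P[OF z] by (simp add: algebra_simps)
  qed
  have 6: "dyn_cov G (\<lambda>j. hderiv G P j) k z = hderiv G (spray_deriv G P) k z
     + ?R z * pdy k P z - 1/2 * pdy k ?R z * P z - chi_curv G k z * P z"
    using 5 by simp
  have 7: "chi_curv G k z = 3/2 * (hderiv G P k z - ?V k z)"
    using chi[OF z, of k] by simp
  show ?thesis
    unfolding 1 2 3 4 Rh_y[OF z] ricci_scalar_projective_change[OF z] 6 7 by (simp add: field_simps)
qed

end

section \<open>The Berwald-Weyl curvature in a chart\<close>

context region
begin

lemma ricci_scalar_local_cong:
  assumes FF: "\<And>i z. z \<in> U \<Longrightarrow> F i z = F' i z" and z: "z \<in> U"
  shows "pdy j (F i) z = pdy j (F' i) z" "pdx j (F i) z = pdx j (F' i) z"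
    and "pdy j (pdy k (F i)) z = pdy j (pdy k (F' i)) z" "pdx j (pdy k (F i)) z = pdx j (pdy k (F' i)) z"
    and "riemann_curv F i k z = riemann_curv F' i k z"
    and "ricci_scalar F z = ricci_scalar F' z"
proof -
  have a: "pdy j (F i) z = pdy j (F' i) z" "pdx j (F i) z = pdx j (F' i) z" if "z \<in> U" for i j z
    by (rule pd_cong[OF FF that], assumption)+
  show "pdy j (F i) z = pdy j (F' i) z" "pdx j (F i) z = pdx j (F' i) z" by (rule a[OF z])+
  show b: "pdy j (pdy k (F i)) z = pdy j (pdy k (F' i)) z" "pdx j (pdy k (F i)) z = pdx j (pdy k (F' i)) z" for i j k
    using pd_cong[OF a(1) z] by auto
  show c: "riemann_curv F i k z = riemann_curv F' i k z" for i k
    by (simp add: riemann_curv_def a b FF z)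
  show "ricci_scalar F z = ricci_scalar F' z"
    by (simp add: ricci_scalar_def ricci_curv_def c)
qed

end

text \<open>The sprays need to agree near the point only. Two coordinate expressions that agree on \<open>U\<close> may differ outside, where
they have no meaning.\<close>

lemma berwald_weyl_cong:
  fixes V V' :: "('a, 'n::finite) tm_vector_field"
  assumes U: "open U" "z \<in> U"
    and eq: "\<And>i z. z \<in> U \<Longrightarrow> coeff_of (projective_spray V \<sigma>) c i z = coeff_of (projective_spray V' \<sigma>') c i z"
  shows "berwald_weyl V \<sigma> c k z = berwald_weyl V' \<sigma>' c k z"
proof -
  interpret region U by unfold_locales (rule U)
  define F F' where F: "F = coeff_of (projective_spray V \<sigma>) c"
    and F': "F' = coeff_of (projective_spray V' \<sigma>') c"
  have FF: "\<And>i z. z \<in> U \<Longrightarrow> F i z = F' i z" using eq by (simp add: F F')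
  note cc = ricci_scalar_local_cong[of F F', OF FF U(2)]
  note R = ricci_scalar_local_cong(6)[of F F', OF FF]
  have R1: "pdy j (ricci_scalar F) z = pdy j (ricci_scalar F') z" "pdx j (ricci_scalar F) z = pdx j (ricci_scalar F') z"
    if "z \<in> U" for j z using pd_cong[OF R that] by auto
  have R2: "pdy j (pdy i (ricci_scalar F)) z = pdy j (pdy i (ricci_scalar F')) z"
     "pdx j (pdy i (ricci_scalar F)) z = pdx j (pdy i (ricci_scalar F')) z" for i j
    using pd_cong[OF R1(1) U(2)] by auto
  show ?thesis
    unfolding berwald_weyl_def Let_def F[symmetric] F'[symmetric]
    by (simp add: hderiv_covector_def hderiv_def nonlin_conn_def berwald_conn_def cc R1 R2 U(2))
qed

lemma coeff_of_projective_spray: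
  fixes V :: "('a, 2) tm_vector_field"
  shows "coeff_of (projective_spray V \<sigma>) c i z = coeff_of V c i z - 1/3 * S_curv (coeff_of V c) (\<sigma> c) z * snd z $ i"
  by (simp add: coeff_of_def projective_spray_def field_simps)

theorem berwald_weyl_formula_in_chart:
  fixes V :: "('a, 2) tm_vector_field"
  assumes V: "surface_spray (slit X) (coeff_of V c)" and X: "open X"
    and \<sigma>: "smooth_map_on X (\<sigma> c)" "\<forall>x\<in>X. \<sigma> c x > 0" and z: "z \<in> slit X"
  shows "berwald_weyl V \<sigma> c k z =
          hderiv (coeff_of V c) (ricci_scalar (coeff_of V c)) k z
          - 1/2 * (\<Sum>m\<in>UNIV. hderiv_covector (coeff_of V c)
                      (\<lambda>j. pdy j (ricci_scalar (coeff_of V c))) k m z * snd z $ m)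
          - 1/3 * (\<Sum>m\<in>UNIV. hderiv_covector (coeff_of V c)
                      (chi_curv (coeff_of V c)) k m z * snd z $ m)"
proof -
  define G where "G = coeff_of V c"
  interpret surface_spray "slit X" G using V by (simp add: G_def)
  note S = S_curv_properties[OF refl \<sigma> X]
  define P where "P = (\<lambda>z. - (1/3) * S_curv G (\<sigma> c) z)"
  interpret projective_change "slit X" G P
  proof
    show "sm P" unfolding P_def by (intro sm_mult sm_const S(1))
    show "homog 1 P" using homog_cmult[OF S(2,1), of "-(1/3)"] by (simp add: P_def)
  qed
  have H: "coeff_of (projective_spray V \<sigma>) c = H"
    by (intro ext) (simp only: H_def coeff_of_projective_spray G_def[symmetric], simp add: P_def)
  have chi: "dyn_cov G (\<lambda>j. pdy j P) k z = hderiv G P k z - 2/3 * chi_curv G k z" if z: "z \<in> slit X" for k z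
  proof -
    have h: "hderiv G P k z = - (1/3) * hderiv G (S_curv G (\<sigma> c)) k z"
      unfolding P_def by (rule hderiv_cmult[OF z S(1)])
    have "dyn_cov G (\<lambda>j. pdy j P) k z = dyn_cov G (\<lambda>j w. - (1/3) * pdy j (S_curv G (\<sigma> c)) w) k z"
      by (rule dyn_cov_cong[OF _ z]) (simp add: P_def S(1) pdy_const)
    also have "\<dots> = - (1/3) * dyn_cov G (\<lambda>j. pdy j (S_curv G (\<sigma> c))) k z"
      by (rule dyn_cov_cmult[OF z sm_pd(2)[OF S(1)]])
    finally show ?thesis using S(3)[OF z, of k] h by simp
  qed
  show ?thesis
    unfolding berwald_weyl_def Let_def H G_def[symmetric]
    using weyl_projective_change[OF z chi] by (simp only: hderiv_covector_along_spray[OF z] H.hderiv_covector_along_spray[OF z])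
qed

lemma open_slit: "open X \<Longrightarrow> open (slit X)"
  unfolding slit_def by (intro open_Times) auto

lemma surface_spray_chart:
  assumes M: "smooth_manifold M A" and V: "spray A V" and c: "c \<in> A"
  shows "surface_spray (slit (coord_domain c)) (coeff_of V c)"
    and "open (coord_domain c)"
proof -
  show oX: "open (coord_domain c)"
    using M c by (auto simp: smooth_manifold_def chart_on_def coord_domain_def)
  interpret region "slit (coord_domain c)" by unfold_locales (rule open_slit[OF oX])
  have smV: "smooth_map_on (slit (coord_domain c)) (V c)"
    using V c by (auto simp: spray_def smooth_vector_field_on_TM0_def)
  have bl: "bounded_linear (\<lambda>v::(real^2)\<times>(real^2). snd v $ i)" for i
    by (intro bounded_linear_compose[OF bounded_linear_vec_nth bounded_linear_snd])
  have "sm (\<lambda>z. snd (V c z) $ i)" for i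
    using smV Ck_on_bounded_linear[OF open_U bl] unfolding smooth_map_on_def by blast
  then have smc: "sm (coeff_of V c i)" for i
    unfolding coeff_of_def[abs_def] by (intro sm_mult sm_const)
  have "homog 2 (coeff_of V c i)" for i
    unfolding homog_def
  proof
    fix z assume z: "z \<in> slit (coord_domain c)"
    obtain x y where xy: "z = (x, y)" by (cases z)
    have "\<forall>c\<in>A. \<forall>(x, y)\<in>slit (coord_domain c).
        \<forall>i. \<forall>r>0. coeff_of V c i (x, r *\<^sub>R y) = r\<^sup>2 * coeff_of V c i (x, y)"
      using V unfolding spray_def by fast
    from bspec[OF bspec[OF this c] z]
    have "coeff_of V c i (x, r *\<^sub>R y) = r\<^sup>2 * coeff_of V c i (x, y)" if "r > 0" for r
      using that by (simp add: xy)
    from euler_relation[OF smooth_map_on_differentiable[OF smc] this] z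
    show "(\<Sum>m\<in>UNIV. snd z $ m * pdy m (coeff_of V c i) z) = 2 * coeff_of V c i z"
      by (simp add: xy)
  qed
  with smc show "surface_spray (slit (coord_domain c)) (coeff_of V c)"
    by unfold_locales auto
qed

text \<open>With the same volume form both sprays have the same associated projective spray: the change \<open>P y\<^sup>i\<close> of the coefficients
changes the S-curvature by \<open>P\<^sub>.\<^sub>m y\<^sup>m + 2 P = 3 P\<close>.\<close>

lemma berwald_weyl_projectively_invariant:
  fixes V V' :: "('a, 2) tm_vector_field"
  assumes M: "smooth_manifold M A" and V: "spray A V" and V': "spray A V'" and c: "c \<in> A"
    and VV: "projectively_equivalent A V V'" and z: "z \<in> slit (coord_domain c)"
  shows "berwald_weyl V' \<sigma> c k z = berwald_weyl V \<sigma> c k z"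
proof -
  let ?U = "slit (coord_domain c)"
  define G G' where "G = coeff_of V c" and "G' = coeff_of V' c"
  interpret surface_spray ?U G using surface_spray_chart[OF M V c] by (simp add: G_def)
  interpret V': surface_spray ?U G' using surface_spray_chart[OF M V' c] by (simp add: G'_def)
  from VV obtain P where "\<forall>c\<in>A. \<forall>(x, y)\<in>slit (coord_domain c).
      (\<forall>r>0. P c (x, r *\<^sub>R y) = r * P c (x, y)) \<and>
      (\<forall>i. coeff_of V' c i (x, y) = coeff_of V c i (x, y) + P c (x, y) * y $ i)"
    unfolding projectively_equivalent_def by blast
  then have eq: "\<forall>(x, y)\<in>?U. (\<forall>r>0. P c (x, r *\<^sub>R y) = r * P c (x, y)) \<and>
      (\<forall>i. G' i (x, y) = G i (x, y) + P c (x, y) * y $ i)"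
    using c unfolding G_def G'_def by (rule bspec)
  have P: "P c (x, r *\<^sub>R y) = r * P c (x, y)" if "(x, y) \<in> ?U" "r > 0" for x y r
    using eq that by blast
  have G': "G' i z = G i z + P c z * snd z $ i" if "z \<in> ?U" for z i
    using bspec[OF eq that] by (cases z) simp
  have nz: "snd z $ 1 * snd z $ 1 + snd z $ 2 * snd z $ 2 \<noteq> 0" if "z \<in> ?U" for z
  proof -
    have "snd z \<noteq> 0" using that by (auto simp: slit_def)
    then show ?thesis by (auto simp: vec_eq_iff forall_2 sum_squares_eq_zero_iff)
  qed
  \<comment> \<open>No regularity of \<open>P\<close> is assumed, but \<open>P = (G'\<^sup>i - G\<^sup>i) y\<^sup>i / \<bar>y\<bar>\<^sup>2\<close> exhibits it as a smooth function away from the zero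
    section.\<close>
  define Q where "Q = (\<lambda>z. ((G' 1 z - G 1 z) * snd z $ 1 + (G' 2 z - G 2 z) * snd z $ 2)
      * inverse (snd z $ 1 * snd z $ 1 + snd z $ 2 * snd z $ 2))"
  have smQ: "sm Q"
  proof -
    have "sm (\<lambda>z. inverse (snd z $ 1 * snd z $ 1 + snd z $ 2 * snd z $ 2))"
      by (rule sm_inverse) (use nz in simp_all)
    then show ?thesis unfolding Q_def by (intro sm_mult sm_add sm_diff sm_snd smG V'.smG)
  qed
  have Q: "Q z = P c z" if "z \<in> ?U" for z
    using nz[OF that] by (simp add: Q_def G'[OF that] field_simps)
  have "homog 1 Q"
    unfolding homog_def
  proof
    fix z assume z: "z \<in> ?U"
    obtain x y where xy: "z = (x, y)" by (cases z)
    have "Q (x, r *\<^sub>R y) = r ^ 1 * Q (x, y)" if "r > 0" for r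
    proof -
      have "(x, r *\<^sub>R y) \<in> ?U" using z that by (auto simp: xy slit_def)
      then show ?thesis using P[of x y r] z that by (simp add: Q xy)
    qed
    from euler_relation[OF smooth_map_on_differentiable[OF smQ] this] z
    show "(\<Sum>m\<in>UNIV. snd z $ m * pdy m Q z) = 1 * Q z" by (simp add: xy)
  qed
  then interpret projective_change ?U G Q by unfold_locales (rule smQ)
  have GH: "G' i z = H i z" if "z \<in> ?U" for i z using G'[OF that] Q[OF that] by (simp add: H_def)
  have S: "S_curv G' (\<sigma> c) z = S_curv G (\<sigma> c) z + 3 * Q z" if z: "z \<in> ?U" for z
  proof -
    have "pdy m (G' m) z = pdy m (H m) z" for m by (rule pd_cong[OF GH z])
    then show ?thesis
      using euler_P[OF z] by (simp add: S_curv_def sum_2 pdy_H[OF z] algebra_simps)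
  qed
  show ?thesis
  proof (rule berwald_weyl_cong[OF open_U z])
    fix i z assume "z \<in> ?U"
    then show "coeff_of (projective_spray V' \<sigma>) c i z = coeff_of (projective_spray V \<sigma>) c i z"
      using S[of z] GH[of z i]
      by (simp add: coeff_of_projective_spray G_def[symmetric] G'_def[symmetric] H_def algebra_simps)
  qed
qed

theorem corollary1p4:
  fixes M :: "'a topology"
    and A :: "('a, 2) chart set"
    and G :: "('a, 2) tm_vector_field"
    and \<sigma> :: "('a, 2) chart \<Rightarrow> real ^ 2 \<Rightarrow> real"
  assumes "smooth_manifold M A"
    and "spray A G"
    and "volume_form A \<sigma>"
  shows
    "(\<forall>\<tau>. volume_form A \<tau> \<longrightarrow>
        (\<forall>c\<in>A. \<forall>z\<in>slit (coord_domain c). \<forall>k.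
           berwald_weyl G \<tau> c k z = berwald_weyl G \<sigma> c k z)) \<and>
     (\<forall>c\<in>A. \<forall>z\<in>slit (coord_domain c). \<forall>k.
        berwald_weyl G \<sigma> c k z =
          hderiv (coeff_of G c) (ricci_scalar (coeff_of G c)) k z
          - 1/2 * (\<Sum>m\<in>UNIV. hderiv_covector (coeff_of G c)
                      (\<lambda>j. pdy j (ricci_scalar (coeff_of G c))) k m z * snd z $ m)
          - 1/3 * (\<Sum>m\<in>UNIV. hderiv_covector (coeff_of G c)
                      (chi_curv (coeff_of G c)) k m z * snd z $ m)) \<and>
     (\<forall>G' \<tau>. spray A G' \<and> projectively_equivalent A G G' \<and> volume_form A \<tau> \<longrightarrow>
        (\<forall>c\<in>A. \<forall>z\<in>slit (coord_domain c). \<forall>k.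
           berwald_weyl G' \<tau> c k z = berwald_weyl G \<sigma> c k z))"
proof -
  have formula: "berwald_weyl V \<tau> c k z =
          hderiv (coeff_of V c) (ricci_scalar (coeff_of V c)) k z
          - 1/2 * (\<Sum>m\<in>UNIV. hderiv_covector (coeff_of V c)
                      (\<lambda>j. pdy j (ricci_scalar (coeff_of V c))) k m z * snd z $ m)
          - 1/3 * (\<Sum>m\<in>UNIV. hderiv_covector (coeff_of V c)
                      (chi_curv (coeff_of V c)) k m z * snd z $ m)"
    if V: "spray A V" and \<tau>: "volume_form A \<tau>" and c: "c \<in> A" and z: "z \<in> slit (coord_domain c)"
    for V \<tau> c k z
    by (rule berwald_weyl_formula_in_chart[OF surface_spray_chart[OF assms(1) V c] _ _ z])
      (use \<tau> c in \<open>auto simp: volume_form_def\<close>)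
  have indep: "berwald_weyl V \<tau> c k z = berwald_weyl V \<sigma> c k z"
    if "spray A V" "volume_form A \<tau>" "c \<in> A" "z \<in> slit (coord_domain c)" for V \<tau> c k z
    by (rule trans[OF formula[OF that] formula[OF that(1) assms(3) that(3,4), symmetric]])
  have proj: "berwald_weyl G' \<tau> c k z = berwald_weyl G \<sigma> c k z"
    if "spray A G'" "projectively_equivalent A G G'" "volume_form A \<tau>" "c \<in> A" "z \<in> slit (coord_domain c)"
    for G' \<tau> c k z
    by (rule trans[OF indep[OF that(1,3,4,5)] berwald_weyl_projectively_invariant[OF assms(1,2) that(1,4,2,5)]])
  show ?thesis
  proof (intro conjI allI impI ballI)
    show "berwald_weyl G \<tau> c k z = berwald_weyl G \<sigma> c k z"
      if "volume_form A \<tau>" "c \<in> A" "z \<in> slit (coord_domain c)" for \<tau> c z k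
      by (rule indep[OF assms(2) that])
    show "berwald_weyl G' \<tau> c k z = berwald_weyl G \<sigma> c k z"
      if "spray A G' \<and> projectively_equivalent A G G' \<and> volume_form A \<tau>"
        "c \<in> A" "z \<in> slit (coord_domain c)" for G' \<tau> c z k
      using that by (intro proj) simp_all
  qed (rule formula[OF assms(2,3)])
qed

end
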